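(* Let $n=M+2^M$ and let $\rho$ be the diagonal $n$-qubit state $\rho=\sum_{Q\in\{0,1\}^n}p(Q)|Q\rangle\langle Q|$ where, writing $\mathcal{P}([M])=\{I_1,\dots,I_{2^M}\}$ for an enumeration of the subsets of $[M]$, $p(Q)=2^{-M}$ if $Q_{M+j}=\mathrm{MAJ}(\{Q_i:i\in I_j\})$ for all $j\in[2^M]$ and $p(Q)=0$ otherwise. Let $\hat\rho_1,\dots,\hat\rho_N$ be classical snapshots of $\rho$ obtained from $N$ copies via random Pauli measurements, and for an observable $O$ let $a(O)=\frac1N\sum_{k=1}^N\mathrm{tr}(O\hat\rho_k)$. Consider the analyst that (1) queries $Z_1,\dots,Z_M$ and receives $a(Z_1),\dots,a(Z_M)$; (2) sets $I=\{i\in[M]:a(Z_i)\ge 9/\sqrt N\}$, lets $j^*$ be the index with $I_{j^*}=I$, and queries $Z_{M+j^*}$. There is a constant $c$ such that if $M\ge c\max(N,\log(1/\delta))$ and $N\ge c\log(1/\delta)$, then with probability at least $1-\delta$, $$|a(Z_{M+j^*})-\mathrm{tr}(Z_{M+j^*}\rho)|\ge0.99.$$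
   Context: $Z_i$ denotes Pauli $Z$ on qubit $i$ tensored with identity elsewhere. $\mathrm{MAJ}$ of a set of bits is $1$ if strictly more than half of them equal $1$ and $0$ otherwise (for $I_j=\emptyset$ the value is fixed to $0$). Random Pauli classical snapshot: for each qubit $j$ independently choose $U_j$ uniformly so as to measure in the $X$, $Y$ or $Z$ basis, measure $U\rho U^\dagger$ ($U=U_1\otimes\cdots\otimes U_n$) in the computational basis obtaining $\hat b\in\{0,1\}^n$, and set $\hat\rho=\bigotimes_{j=1}^n\big(3U_j^\dagger|\hat b_j\rangle\langle\hat b_j|U_j-\mathbb{I}\big)$; the $N$ snapshots come from $N$ independent copies. *)

theory Defs
  imports "HOL-Analysis.Analysis" "HOL-Library.FuncSet" "Jordan_Normal_Form.Matrix"
begin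

definition mtrace :: "complex mat \<Rightarrow> complex" where
  "mtrace A = (\<Sum>i<dim_row A. A $$ (i, i))"

definition dagger :: "complex mat \<Rightarrow> complex mat" where
  "dagger A = mat (dim_col A) (dim_row A) (\<lambda>(i, j). cnj (A $$ (j, i)))"

definition kron :: "complex mat \<Rightarrow> complex mat \<Rightarrow> complex mat" where
  "kron A B = mat (dim_row A * dim_row B) (dim_col A * dim_col B)
     (\<lambda>(i, j). A $$ (i div dim_row B, j div dim_col B) * B $$ (i mod dim_row B, j mod dim_col B))"

definition tensor :: "nat \<Rightarrow> (nat \<Rightarrow> complex mat) \<Rightarrow> complex mat" where
  "tensor n F = foldr (\<lambda>j acc. kron (F j) acc) [1..<n+1] (1\<^sub>m 1)"

definition pauliZ :: "complex mat" where
  "pauliZ = mat_of_rows_list 2 [[1, 0], [0, -1]]"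

definition Zq :: "nat \<Rightarrow> nat \<Rightarrow> complex mat" where
  "Zq n i = tensor n (\<lambda>j. if j = i then pauliZ else 1\<^sub>m 2)"

definition bitstrings :: "nat \<Rightarrow> (nat \<Rightarrow> bool) set" where
  "bitstrings n = {1..n} \<rightarrow>\<^sub>E (UNIV :: bool set)"

definition bidx :: "nat \<Rightarrow> (nat \<Rightarrow> bool) \<Rightarrow> nat" where
  "bidx n Q = (\<Sum>i\<in>{1..n}. if Q i then 2 ^ (n - i) else 0)"

definition ket :: "nat \<Rightarrow> (nat \<Rightarrow> bool) \<Rightarrow> complex vec" where
  "ket n Q = unit_vec (2 ^ n) (bidx n Q)"

definition diag_state :: "nat \<Rightarrow> ((nat \<Rightarrow> bool) \<Rightarrow> real) \<Rightarrow> complex mat" where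
  "diag_state n p = mat (2 ^ n) (2 ^ n)
     (\<lambda>(r, s). \<Sum>Q\<in>bitstrings n. complex_of_real (p Q) * (ket n Q $ r) * cnj (ket n Q $ s))"

definition maj :: "nat set \<Rightarrow> (nat \<Rightarrow> bool) \<Rightarrow> bool" where
  "maj I Q = (if I = {} then False else 2 * card {i\<in>I. Q i} > card I)"

definition p_hard :: "nat \<Rightarrow> (nat \<Rightarrow> nat set) \<Rightarrow> (nat \<Rightarrow> bool) \<Rightarrow> real" where
  "p_hard M enum Q =
     (if \<forall>j\<in>{1..2 ^ M}. Q (M + j) = maj (enum j) Q then 1 / 2 ^ M else 0)"

definition rho_hard :: "nat \<Rightarrow> (nat \<Rightarrow> nat set) \<Rightarrow> complex mat" where
  "rho_hard M enum = diag_state (M + 2 ^ M) (p_hard M enum)"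

text \<open>Basis choice per qubit: 0 = X, 1 = Y, 2 = Z.  U_X = H, U_Y = H S^dagger, U_Z = I,
  so that measuring U sigma U^dagger in the computational basis measures in the chosen basis.\<close>
definition hadamard :: "complex mat" where
  "hadamard = mat_of_rows_list 2 [[1 / sqrt 2, 1 / sqrt 2], [1 / sqrt 2, - 1 / sqrt 2]]"

definition sdag :: "complex mat" where
  "sdag = mat_of_rows_list 2 [[1, 0], [0, - \<i>]]"

definition Ubasis :: "nat \<Rightarrow> complex mat" where
  "Ubasis u = (if u = 0 then hadamard else if u = 1 then hadamard * sdag else 1\<^sub>m 2)"

definition ket1 :: "bool \<Rightarrow> complex vec" where
  "ket1 b = unit_vec 2 (if b then 1 else 0)"

definition proj1 :: "bool \<Rightarrow> complex mat" where
  "proj1 b = mat 2 2 (\<lambda>(r, s). ket1 b $ r * cnj (ket1 b $ s))"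

text \<open>A single measurement record: for each qubit j in 1..n a basis choice u_j in {0,1,2}
  and an outcome bit b_j.\<close>
definition records :: "nat \<Rightarrow> (nat \<Rightarrow> nat \<times> bool) set" where
  "records n = {1..n} \<rightarrow>\<^sub>E ({0, 1, 2} \<times> (UNIV :: bool set))"

text \<open>Probability of a record: (1/3)^n for the uniform basis choices times the Born
  probability <b| U rho U^dagger |b>.\<close>
definition rec_prob :: "nat \<Rightarrow> complex mat \<Rightarrow> (nat \<Rightarrow> nat \<times> bool) \<Rightarrow> real" where
  "rec_prob n rho r =
     (let U = tensor n (\<lambda>j. Ubasis (fst (r j)));
          k = bidx n (\<lambda>j. if j \<in> {1..n} then snd (r j) else undefined)
      in (1 / 3) ^ n * Re ((U * rho * dagger U) $$ (k, k)))"

definition snapshot :: "nat \<Rightarrow> (nat \<Rightarrow> nat \<times> bool) \<Rightarrow> complex mat" where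
  "snapshot n r = tensor n (\<lambda>j.
      3 \<cdot>\<^sub>m (dagger (Ubasis (fst (r j))) * proj1 (snd (r j)) * Ubasis (fst (r j))) - 1\<^sub>m 2)"

definition shots :: "nat \<Rightarrow> nat \<Rightarrow> (nat \<Rightarrow> nat \<Rightarrow> nat \<times> bool) set" where
  "shots N n = {1..N} \<rightarrow>\<^sub>E records n"

definition shots_prob :: "nat \<Rightarrow> nat \<Rightarrow> complex mat \<Rightarrow> (nat \<Rightarrow> nat \<Rightarrow> nat \<times> bool) \<Rightarrow> real" where
  "shots_prob N n rho w = (\<Prod>k\<in>{1..N}. rec_prob n rho (w k))"

definition snap_Prob :: "nat \<Rightarrow> nat \<Rightarrow> complex mat \<Rightarrow> ((nat \<Rightarrow> nat \<Rightarrow> nat \<times> bool) \<Rightarrow> bool) \<Rightarrow> real" where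
  "snap_Prob N n rho E = (\<Sum>w\<in>shots N n. if E w then shots_prob N n rho w else 0)"

definition est :: "nat \<Rightarrow> nat \<Rightarrow> (nat \<Rightarrow> nat \<Rightarrow> nat \<times> bool) \<Rightarrow> complex mat \<Rightarrow> real" where
  "est N n w Obs = (1 / real N) * (\<Sum>k\<in>{1..N}. Re (mtrace (Obs * snapshot n (w k))))"

definition analyst_I :: "nat \<Rightarrow> nat \<Rightarrow> (nat \<Rightarrow> nat \<Rightarrow> nat \<times> bool) \<Rightarrow> nat set" where
  "analyst_I M N w = {i\<in>{1..M}. est N (M + 2 ^ M) w (Zq (M + 2 ^ M) i) \<ge> 9 / sqrt (real N)}"

definition analyst_j :: "nat \<Rightarrow> (nat \<Rightarrow> nat set) \<Rightarrow> nat \<Rightarrow> (nat \<Rightarrow> nat \<Rightarrow> nat \<times> bool) \<Rightarrow> nat" where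
  "analyst_j M enum N w = (THE j. j \<in> {1..2 ^ M} \<and> enum j = analyst_I M N w)"

end

(* A snapshot of a diagonal state gives Z_i the value 3 s_i if qubit i was measured in the Z basis and
   0 otherwise, where s_i is the sign of its hidden bit. Qubits selected because their estimate is
   at least 9 / sqrt N have hidden signs correlated with every shot: on a selected qubit the measured signs
   sum to at least 3 sqrt N over the N shots. Since a qubit is selected with probability bounded
   below, M >= c N qubits suffice for the majority over the selected set to be 0 in all but a small
   fraction of the shots. Hence a(Z_(M+j)) concentrates around 1, whereas the true expectation of that
   majority sign is the probability of a tie, which is small for a large selected set. *)
theory Submission
  imports Defs
begin

text \<open>The scale M of order N comes from comparing drift with noise. Given its selection, a
  qubit has a hidden sign of mean at least 3 / sqrt N in each single shot. Hence m selected qubits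
  give a drift of 3 m / sqrt N against fluctuations of order sqrt m, and m must be a large multiple
  of N before a wrong majority becomes rare in a shot. Even then it has only a small constant
  probability, and the shots are coupled through the selection, so failures are controlled jointly
  for whole sets of shots.

  Adaptivity is harmless in the last step: once the hidden bits and the records of the first M
  qubits are fixed, the index of the final query is fixed too, and the records of the queried qubit
  are still a fresh independent sample.

  The error budget: at most N / 1000 bad shots leave a conditional mean of at least 0.998 for the
  last estimate, random deviation is allowed to lower it to 0.991, and ties contribute at most 0.001
  to the true expectation, which leaves 0.99.\<close>

section \<open>Tensor products in the computational basis\<close>

text \<open>A version of \<open>bidx\<close> for arbitrary lists of qubits. The head is the most
  significant digit, as the outermost factor of the \<open>foldr\<close> in \<open>tensor\<close>
  is, so that matrix entries can be computed by list induction.\<close>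

fun list_index :: "nat list \<Rightarrow> (nat \<Rightarrow> bool) \<Rightarrow> nat" where
  "list_index [] Q = 0"
| "list_index (x # xs) Q = of_bool (Q x) * 2 ^ length xs + list_index xs Q"

lemma list_index_less: "list_index xs Q < 2 ^ length xs"
  by (induction xs) auto

lemma kron_carrier:
  assumes "A \<in> carrier_mat a b" "B \<in> carrier_mat c d"
  shows "kron A B \<in> carrier_mat (a * c) (b * d)"
  using assms by (auto simp: kron_def)

lemma foldr_kron_carrier:
  assumes "\<And>j. j \<in> set xs \<Longrightarrow> F j \<in> carrier_mat 2 2"
  shows "foldr (\<lambda>j acc. kron (F j) acc) xs (1\<^sub>m 1) \<in> carrier_mat (2 ^ length xs) (2 ^ length xs)"
  using assms
proof (induction xs)
  case (Cons x xs)
  then show ?case using kron_carrier[of "F x" 2 2] by auto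
qed auto

lemma kron_entry:
  fixes Q R :: bool
  assumes "A \<in> carrier_mat 2 2" "B \<in> carrier_mat m m" "i < m" "j < m"
  shows "kron A B $$ (of_bool Q * m + i, of_bool R * m + j)
       = A $$ (of_bool Q, of_bool R) * B $$ (i, j)"
  using assms by (auto simp: kron_def)

lemma foldr_kron_entry:
  assumes "\<And>j. j \<in> set xs \<Longrightarrow> F j \<in> carrier_mat 2 2"
  shows "foldr (\<lambda>j acc. kron (F j) acc) xs (1\<^sub>m 1) $$ (list_index xs Q, list_index xs R)
       = (\<Prod>j\<leftarrow>xs. F j $$ (of_bool (Q j), of_bool (R j)))"
  using assms
proof (induction xs)
  case (Cons x xs)
  have "foldr (\<lambda>j acc. kron (F j) acc) xs (1\<^sub>m 1) \<in> carrier_mat (2 ^ length xs) (2 ^ length xs)"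
    by (rule foldr_kron_carrier) (use Cons.prems in auto)
  from kron_entry[OF _ this list_index_less list_index_less, of "F x" "Q x" Q "R x" R]
  show ?case using Cons by auto
qed auto

lemma list_index_snoc: "list_index (xs @ [y]) Q = 2 * list_index xs Q + of_bool (Q y)"
  by (induction xs) auto

lemma bidx_Suc: "bidx (Suc n) Q = 2 * bidx n Q + of_bool (Q (Suc n))"
proof -
  have "(\<Sum>i\<in>{1..n}. if Q i then 2 ^ (Suc n - i) else 0) = (\<Sum>i\<in>{1..n}. 2 * (if Q i then 2 ^ (n - i) else (0::nat)))"
    by (rule sum.cong) (auto simp: Suc_diff_le)
  then show ?thesis by (simp add: bidx_def sum_distrib_left)
qed

lemma bidx_eq_list_index: "bidx n Q = list_index [1..<n + 1] Q"
proof (induction n)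
  case 0
  then show ?case by (simp add: bidx_def)
next
  case (Suc n)
  have "[1..<Suc n + 1] = [1..<n + 1] @ [Suc n]" by simp
  then show ?case by (simp only: bidx_Suc Suc list_index_snoc)
qed

lemma bidx_less: "bidx n Q < 2 ^ n"
  using list_index_less[of "[1..<n + 1]" Q] by (simp add: bidx_eq_list_index del: upt_Suc)

lemma bidx_eqD: "bidx n Q = bidx n R \<Longrightarrow> i \<in> {1..n} \<Longrightarrow> Q i = R i"
proof (induction n)
  case (Suc n)
  have "of_bool (Q (Suc n)) = (of_bool (R (Suc n)) :: nat)"
    using arg_cong[OF Suc.prems(1), of "\<lambda>k. k mod 2"] by (simp add: bidx_Suc)
  moreover from this have "bidx n Q = bidx n R"
    using Suc.prems(1) by (simp add: bidx_Suc)
  ultimately show ?case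
    using Suc.IH Suc.prems(2) by (cases "i = Suc n") (auto simp: of_bool_def split: if_splits)
qed simp

lemma finite_bitstrings [simp]: "finite (bitstrings n)"
  by (simp add: bitstrings_def finite_PiE)

lemma bij_betw_bidx: "bij_betw (bidx n) (bitstrings n) {..<2 ^ n}"
proof -
  have inj: "inj_on (bidx n) (bitstrings n)"
  proof (rule inj_onI)
    fix Q R assume "Q \<in> bitstrings n" "R \<in> bitstrings n" "bidx n Q = bidx n R"
    then show "Q = R"
      unfolding bitstrings_def by (intro PiE_ext[of Q _ _ R]) (use bidx_eqD in blast)+
  qed
  moreover have "bidx n ` bitstrings n = {..<2 ^ n}"
  proof (rule card_subset_eq)
    show "card (bidx n ` bitstrings n) = card {..<(2::nat) ^ n}"
      by (simp add: card_image[OF inj]) (simp add: bitstrings_def card_PiE)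
  qed (auto simp: bidx_less)
  ultimately show ?thesis by (simp add: bij_betw_def)
qed

lemma sum_bitstrings: "(\<Sum>l<2 ^ n. f l) = (\<Sum>Q\<in>bitstrings n. f (bidx n Q))"
  by (rule sum.reindex_bij_betw[symmetric, OF bij_betw_bidx])

lemma tensor_carrier:
  assumes "\<And>j. j \<in> {1..n} \<Longrightarrow> F j \<in> carrier_mat 2 2"
  shows "tensor n F \<in> carrier_mat (2 ^ n) (2 ^ n)"
  using foldr_kron_carrier[of "[1..<n + 1]" F] assms by (simp add: tensor_def del: upt_Suc)

lemma tensor_entry:
  assumes "\<And>j. j \<in> {1..n} \<Longrightarrow> F j \<in> carrier_mat 2 2"
  shows "tensor n F $$ (bidx n Q, bidx n R) = (\<Prod>j\<in>{1..n}. F j $$ (of_bool (Q j), of_bool (R j)))"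
proof -
  have "tensor n F $$ (bidx n Q, bidx n R)
      = (\<Prod>j\<leftarrow>[1..<n + 1]. F j $$ (of_bool (Q j), of_bool (R j)))"
    unfolding tensor_def bidx_eq_list_index by (rule foldr_kron_entry) (use assms in auto)
  also have "\<dots> = (\<Prod>j\<in>{1..n}. F j $$ (of_bool (Q j), of_bool (R j)))"
    by (subst prod.distinct_set_conv_list[symmetric]) (auto intro: prod.cong)
  finally show ?thesis .
qed

lemma sum_prod_bitstrings:
  fixes f :: "nat \<Rightarrow> bool \<Rightarrow> 'a::comm_semiring_1"
  shows "(\<Sum>Q\<in>bitstrings n. \<Prod>j\<in>{1..n}. f j (Q j)) = (\<Prod>j\<in>{1..n}. \<Sum>b\<in>UNIV. f j b)"
  unfolding bitstrings_def by (rule prod_sum_PiE[symmetric]) auto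

lemma mtrace_mult:
  assumes "A \<in> carrier_mat m m" "B \<in> carrier_mat m m"
  shows "mtrace (A * B) = (\<Sum>i<m. \<Sum>j<m. A $$ (i, j) * B $$ (j, i))"
  using assms unfolding mtrace_def
  by (auto simp: scalar_prod_def lessThan_atLeast0 intro!: sum.cong)

text \<open>Entries of both factors are products over qubits, so the double sum over bit strings
  distributes into a product of one-qubit double sums, each of which is again a trace.\<close>

lemma mtrace_mult_tensor:
  assumes F: "\<And>j. j \<in> {1..n} \<Longrightarrow> F j \<in> carrier_mat 2 2"
    and G: "\<And>j. j \<in> {1..n} \<Longrightarrow> G j \<in> carrier_mat 2 2"
  shows "mtrace (tensor n F * tensor n G) = (\<Prod>j\<in>{1..n}. mtrace (F j * G j))"
proof -
  have "mtrace (tensor n F * tensor n G)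
      = (\<Sum>Q\<in>bitstrings n. \<Sum>R\<in>bitstrings n.
           tensor n F $$ (bidx n Q, bidx n R) * tensor n G $$ (bidx n R, bidx n Q))"
    by (subst mtrace_mult[OF tensor_carrier[OF F] tensor_carrier[OF G]]) (simp_all add: sum_bitstrings)
  also have "\<dots> = (\<Sum>Q\<in>bitstrings n. \<Sum>R\<in>bitstrings n. \<Prod>j\<in>{1..n}.
      F j $$ (of_bool (Q j), of_bool (R j)) * G j $$ (of_bool (R j), of_bool (Q j)))"
    by (simp only: tensor_entry[OF F] tensor_entry[OF G] prod.distrib)
  also have "\<dots> = (\<Sum>Q\<in>bitstrings n. \<Prod>j\<in>{1..n}. \<Sum>b\<in>UNIV.
      F j $$ (of_bool (Q j), of_bool b) * G j $$ (of_bool b, of_bool (Q j)))"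
  proof (rule sum.cong[OF refl])
    fix Q
    show "(\<Sum>R\<in>bitstrings n. \<Prod>j\<in>{1..n}.
        F j $$ (of_bool (Q j), of_bool (R j)) * G j $$ (of_bool (R j), of_bool (Q j)))
      = (\<Prod>j\<in>{1..n}. \<Sum>b\<in>UNIV.
        F j $$ (of_bool (Q j), of_bool b) * G j $$ (of_bool b, of_bool (Q j)))"
      by (rule sum_prod_bitstrings[of
          "\<lambda>j b. F j $$ (of_bool (Q j), of_bool b) * G j $$ (of_bool b, of_bool (Q j))"])
  qed
  also have "\<dots> = (\<Prod>j\<in>{1..n}. \<Sum>a\<in>UNIV. \<Sum>b\<in>UNIV.
      F j $$ (of_bool a, of_bool b) * G j $$ (of_bool b, of_bool a))"
    by (rule sum_prod_bitstrings[of "\<lambda>j a. \<Sum>b\<in>UNIV. F j $$ (of_bool a, of_bool b) * G j $$ (of_bool b, of_bool a)"])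
  also have "\<dots> = (\<Prod>j\<in>{1..n}. mtrace (F j * G j))"
    by (intro prod.cong refl)
       (simp add: mtrace_mult[OF F G] UNIV_bool numeral_2_eq_2 algebra_simps)
  finally show ?thesis .
qed

section \<open>Snapshots and measurement records of a diagonal state\<close>

text \<open>The eigenvalue of Z read off from the record, and 0 in the bases X and Y. The snapshot
  yields 3 times this value; the 3 compensates the probability 1/3 of measuring in the Z
  basis.\<close>

definition shot_value :: "nat \<times> bool \<Rightarrow> real" where
  "shot_value r = (if fst r = 2 then if snd r then -1 else 1 else 0)"

text \<open>The law of basis and outcome given the hidden bit \<open>q\<close>: each basis has
  probability 1/3, Z reproduces \<open>q\<close> with certainty, X and Y toss a fair coin.\<close>

definition shot_weight :: "bool \<Rightarrow> nat \<times> bool \<Rightarrow> real" where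
  "shot_weight q r = (if fst r = 2 then if snd r = q then 1 / 3 else 0 else 1 / 6)"

definition bit_sign :: "bool \<Rightarrow> real" where
  "bit_sign q = (if q then -1 else 1)"

lemma pauliZ_carrier: "pauliZ \<in> carrier_mat 2 2"
  by (simp add: pauliZ_def mat_of_rows_list_def numeral_2_eq_2)

lemma Ubasis_carrier: "Ubasis u \<in> carrier_mat 2 2"
  by (auto simp: Ubasis_def hadamard_def sdag_def mat_of_rows_list_def numeral_2_eq_2)

lemma dagger_carrier: "A \<in> carrier_mat m k \<Longrightarrow> dagger A \<in> carrier_mat k m"
  by (simp add: dagger_def)

lemma proj1_carrier: "proj1 b \<in> carrier_mat 2 2"
  by (simp add: proj1_def)

lemma sum_lessThan_2: "(\<Sum>i<(2::nat). f i) = f 0 + f 1"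
  by (simp add: numeral_2_eq_2)

lemma of_real_sqrt2_sq: "complex_of_real (sqrt 2) * complex_of_real (sqrt 2) = 2"
  by (simp flip: of_real_mult)

lemma Ubasis_entries:
  "Ubasis u $$ (0, 0) = (if u = 0 \<or> u = 1 then 1 / sqrt 2 else 1)"
  "Ubasis u $$ (0, 1) = (if u = 0 then 1 / sqrt 2 else if u = 1 then - \<i> / sqrt 2 else 0)"
  "Ubasis u $$ (1, 0) = (if u = 0 \<or> u = 1 then 1 / sqrt 2 else 0)"
  "Ubasis u $$ (1, 1) = (if u = 0 then - 1 / sqrt 2 else if u = 1 then \<i> / sqrt 2 else 1)"
  by (auto simp: Ubasis_def hadamard_def sdag_def mat_of_rows_list_def scalar_prod_def
        numeral_2_eq_2)

lemmas Ubasis_entries' = Ubasis_entries[unfolded One_nat_def]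

lemma local_snapshot_carrier:
  "3 \<cdot>\<^sub>m (dagger (Ubasis u) * proj1 b * Ubasis u) - 1\<^sub>m 2 \<in> carrier_mat 2 2"
  using Ubasis_carrier[of u] dagger_carrier[OF Ubasis_carrier[of u]] proj1_carrier[of b] by auto

lemma mtrace_pauliZ:
  assumes "A \<in> carrier_mat 2 2"
  shows "mtrace (pauliZ * A) = A $$ (0, 0) - A $$ (1, 1)"
  using assms by (subst mtrace_mult[OF pauliZ_carrier])
    (auto simp: sum_lessThan_2 pauliZ_def mat_of_rows_list_def)

text \<open>Only diagonal entries of a local snapshot are needed, since it is traced against
  \<open>pauliZ\<close> or the identity; the rank-one projector picks row \<open>b\<close> of
  \<open>A\<close>.\<close>

lemma conj_proj1_diag:
  assumes "A \<in> carrier_mat 2 2" "i < 2"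
  shows "(dagger A * proj1 b * A) $$ (i, i) = cnj (A $$ (of_bool b, i)) * A $$ (of_bool b, i)"
proof -
  have lt: "{0..<2} = {0, 1::nat}" by auto
  have "(dagger A * proj1 b * A) $$ (i, i)
     = (\<Sum>k\<in>{0..<2}. (\<Sum>l\<in>{0..<2}. cnj (A $$ (l, i)) * proj1 b $$ (l, k)) * A $$ (k, i))"
    using assms by (simp add: scalar_prod_def dagger_def proj1_def)
  also have "\<dots> = cnj (A $$ (of_bool b, i)) * A $$ (of_bool b, i)"
    by (cases b) (simp_all add: lt proj1_def ket1_def)
  finally show ?thesis .
qed

lemma local_snapshot_diag:
  assumes "i < 2"
  shows "(3 \<cdot>\<^sub>m (dagger (Ubasis u) * proj1 b * Ubasis u) - 1\<^sub>m 2) $$ (i, i)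
    = 3 * (cnj (Ubasis u $$ (of_bool b, i)) * Ubasis u $$ (of_bool b, i)) - 1"
proof -
  have "dim_row (dagger (Ubasis u)) = 2" "dim_col (Ubasis u) = 2"
    using Ubasis_carrier[of u] dagger_carrier[OF Ubasis_carrier[of u]] by (auto simp del: One_nat_def)
  then have "(3 \<cdot>\<^sub>m (dagger (Ubasis u) * proj1 b * Ubasis u) - 1\<^sub>m 2) $$ (i, i)
    = 3 * (dagger (Ubasis u) * proj1 b * Ubasis u) $$ (i, i) - 1"
    using assms by simp
  then show ?thesis using conj_proj1_diag[OF Ubasis_carrier assms] by simp
qed
text \<open>The trace is 3 - 2, so qubits on which the observable acts as the identity contribute a
  factor 1.\<close>

lemma mtrace_local_snapshot:
  "mtrace (3 \<cdot>\<^sub>m (dagger (Ubasis u) * proj1 b * Ubasis u) - 1\<^sub>m 2) = 1"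
proof -
  have "dim_row (3 \<cdot>\<^sub>m (dagger (Ubasis u) * proj1 b * Ubasis u) - 1\<^sub>m 2) = 2"
    by simp
  then show ?thesis
    by (cases b) (simp_all add: mtrace_def sum_lessThan_2 local_snapshot_diag Ubasis_entries' of_real_sqrt2_sq
      del: index_minus_mat)
qed
text \<open>For X and Y all entries of \<open>Ubasis u\<close> have modulus 1 / sqrt 2, so the two
  diagonal entries of the snapshot coincide and cancel against Z.\<close>

lemma mtrace_pauliZ_local_snapshot:
  assumes "u \<in> {0, 1, 2}"
  shows "mtrace (pauliZ * (3 \<cdot>\<^sub>m (dagger (Ubasis u) * proj1 b * Ubasis u) - 1\<^sub>m 2))
    = of_real (3 * shot_value (u, b))"
  unfolding mtrace_pauliZ[OF local_snapshot_carrier]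
  using assms 
  by (cases b) (auto simp: local_snapshot_diag Ubasis_entries' of_real_sqrt2_sq shot_value_def
       simp del: index_minus_mat)

lemma mtrace_Zq_snapshot:
  assumes "r \<in> records n" "i \<in> {1..n}"
  shows "Re (mtrace (Zq n i * snapshot n r)) = 3 * shot_value (r i)"
proof -
  have "mtrace (Zq n i * snapshot n r) = (\<Prod>j\<in>{1..n}. mtrace ((if j = i then pauliZ else 1\<^sub>m 2) *
     (3 \<cdot>\<^sub>m (dagger (Ubasis (fst (r j))) * proj1 (snd (r j)) * Ubasis (fst (r j))) - 1\<^sub>m 2)))"
    unfolding Zq_def snapshot_def
    by (rule mtrace_mult_tensor) (auto simp: pauliZ_carrier local_snapshot_carrier simp del: One_nat_def)
  also have "\<dots> = (\<Prod>j\<in>{1..n}. if j = i then of_real (3 * shot_value (r j)) else 1)"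
  proof (rule prod.cong[OF refl])
    fix j assume "j \<in> {1..n}"
    then have "fst (r j) \<in> {0, 1, 2}"
      using PiE_mem[OF assms(1)[unfolded records_def], of j] by auto
    from mtrace_pauliZ_local_snapshot[OF this, of "snd (r j)"]
    show "mtrace ((if j = i then pauliZ else 1\<^sub>m 2) *
        (3 \<cdot>\<^sub>m (dagger (Ubasis (fst (r j))) * proj1 (snd (r j)) * Ubasis (fst (r j))) - 1\<^sub>m 2))
      = (if j = i then of_real (3 * shot_value (r j)) else 1)"
      using mtrace_local_snapshot[of "fst (r j)" "snd (r j)"]
        left_mult_one_mat[OF local_snapshot_carrier[of "fst (r j)" "snd (r j)"]]
      by (cases "j = i") (simp_all del: of_real_mult)
  qed
  also have "\<dots> = of_real (3 * shot_value (r i))"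
    using assms by simp
  finally show ?thesis by simp
qed

lemma diag_state_carrier: "diag_state n p \<in> carrier_mat (2 ^ n) (2 ^ n)"
  by (simp add: diag_state_def)

lemma diag_state_entry:
  assumes "Q \<in> bitstrings n" "R \<in> bitstrings n"
  shows "diag_state n p $$ (bidx n Q, bidx n R) = (if Q = R then of_real (p Q) else 0)"
proof -
  have eq: "bidx n S = bidx n T \<longleftrightarrow> S = T" if "S \<in> bitstrings n" "T \<in> bitstrings n" for S T
    using that bij_betw_bidx[of n] by (auto simp: bij_betw_def inj_on_def)
  have "diag_state n p $$ (bidx n Q, bidx n R)
      = (\<Sum>S\<in>bitstrings n. complex_of_real (p S) * (ket n S $ bidx n Q) * cnj (ket n S $ bidx n R))"
    unfolding diag_state_def by (simp add: bidx_less)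
  also have "\<dots> = (\<Sum>S\<in>bitstrings n. if S = Q then if Q = R then of_real (p Q) else 0 else 0)"
    using assms by (intro sum.cong refl) (simp add: ket_def bidx_less eq eq_commute)
  finally show ?thesis using assms by simp
qed

lemma mtrace_Zq_diag_state:
  assumes "i \<in> {1..n}"
  shows "Re (mtrace (Zq n i * diag_state n p)) = (\<Sum>Q\<in>bitstrings n. p Q * bit_sign (Q i))"
proof -
  have Z: "(if j = i then pauliZ else 1\<^sub>m 2) \<in> carrier_mat 2 2" for j
    by (simp add: pauliZ_carrier)
  have "mtrace (Zq n i * diag_state n p)
      = (\<Sum>Q\<in>bitstrings n. \<Sum>R\<in>bitstrings n.
           Zq n i $$ (bidx n Q, bidx n R) * diag_state n p $$ (bidx n R, bidx n Q))"
    unfolding Zq_def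
    by (subst mtrace_mult[OF tensor_carrier[OF Z] diag_state_carrier]) (simp add: sum_bitstrings)
  also have "\<dots> = (\<Sum>Q\<in>bitstrings n. \<Sum>R\<in>bitstrings n.
           if R = Q then Zq n i $$ (bidx n Q, bidx n Q) * of_real (p Q) else 0)"
    by (intro sum.cong refl) (simp add: diag_state_entry)
  also have "\<dots> = (\<Sum>Q\<in>bitstrings n. Zq n i $$ (bidx n Q, bidx n Q) * of_real (p Q))"
    by simp
  also have "\<dots> = (\<Sum>Q\<in>bitstrings n. of_real (p Q * bit_sign (Q i)))"
  proof (intro sum.cong refl)
    fix Q
    have "Zq n i $$ (bidx n Q, bidx n Q)
        = (\<Prod>j\<in>{1..n}. (if j = i then pauliZ else 1\<^sub>m 2) $$ (of_bool (Q j), of_bool (Q j)))"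
      unfolding Zq_def by (rule tensor_entry[OF Z])
    also have "\<dots> = (\<Prod>j\<in>{1..n}. if j = i then of_real (bit_sign (Q j)) else 1)"
      by (intro prod.cong refl)
        (auto simp: pauliZ_def mat_of_rows_list_def bit_sign_def of_bool_def)
    also have "\<dots> = of_real (bit_sign (Q i))"
      using assms by simp
    finally show "Zq n i $$ (bidx n Q, bidx n Q) * of_real (p Q) = of_real (p Q * bit_sign (Q i))"
      by simp
  qed
  finally show ?thesis by simp
qed

lemma Ubasis_abs_sq:
  assumes "u \<in> {0, 1, 2}"
  shows "(1 / 3) * (Ubasis u $$ (of_bool b, of_bool q) * cnj (Ubasis u $$ (of_bool b, of_bool q)))
    = of_real (shot_weight q (u, b))"
  using assms
  by (cases b; cases q) (auto simp: Ubasis_entries' of_real_sqrt2_sq shot_weight_def)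

lemma conjugate_entry:
  assumes "A \<in> carrier_mat m m" "D \<in> carrier_mat m m" "k < m"
  shows "(A * D * dagger A) $$ (k, k)
    = (\<Sum>R<m. \<Sum>Q<m. A $$ (k, Q) * D $$ (Q, R) * cnj (A $$ (k, R)))"
proof -
  have "(A * D * dagger A) $$ (k, k)
      = (\<Sum>R\<in>{0..<m}. (\<Sum>Q\<in>{0..<m}. A $$ (k, Q) * D $$ (Q, R)) * cnj (A $$ (k, R)))"
    using assms by (simp add: scalar_prod_def dagger_def)
  then show ?thesis by (simp add: sum_distrib_right lessThan_atLeast0)
qed

text \<open>A diagonal state collapses the double sum of the Born rule to a single one, and squared
  amplitudes factor over the qubits. The records behave as if a string were drawn from
  \<open>p\<close> and its bits were then measured independently, which is what makes hidden bits
  available.\<close>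

lemma rec_prob_diag_state:
  assumes "r \<in> records n"
  shows "rec_prob n (diag_state n p) r
    = (\<Sum>Q\<in>bitstrings n. p Q * (\<Prod>j\<in>{1..n}. shot_weight (Q j) (r j)))"
proof -
  let ?U = "tensor n (\<lambda>j. Ubasis (fst (r j)))"
  let ?b = "\<lambda>j. snd (r j)"
  have U: "?U \<in> carrier_mat (2 ^ n) (2 ^ n)"
    by (rule tensor_carrier) (rule Ubasis_carrier)
  have k: "bidx n (\<lambda>j. if j \<in> {1..n} then snd (r j) else undefined) = bidx n ?b"
    unfolding bidx_def by (rule sum.cong) auto
  have "(?U * diag_state n p * dagger ?U) $$ (bidx n ?b, bidx n ?b)
      = (\<Sum>R<2 ^ n. \<Sum>Q<2 ^ n. ?U $$ (bidx n ?b, Q) * diag_state n p $$ (Q, R) * cnj (?U $$ (bidx n ?b, R)))"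
    by (rule conjugate_entry[OF U diag_state_carrier bidx_less])
  also have "\<dots> = (\<Sum>R\<in>bitstrings n. \<Sum>Q\<in>bitstrings n. if Q = R then
      of_real (p R) * (?U $$ (bidx n ?b, bidx n R) * cnj (?U $$ (bidx n ?b, bidx n R))) else 0)"
    unfolding sum_bitstrings by (intro sum.cong refl) (simp add: diag_state_entry)
  also have "\<dots> = (\<Sum>R\<in>bitstrings n.
      of_real (p R) * (?U $$ (bidx n ?b, bidx n R) * cnj (?U $$ (bidx n ?b, bidx n R))))"
    by simp
  finally have *: "(?U * diag_state n p * dagger ?U) $$ (bidx n ?b, bidx n ?b) = \<dots>" .
  have "complex_of_real ((1 / 3) ^ n) * (?U * diag_state n p * dagger ?U) $$ (bidx n ?b, bidx n ?b)
      = (\<Sum>Q\<in>bitstrings n. of_real (p Q * (\<Prod>j\<in>{1..n}. shot_weight (Q j) (r j))))"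
    unfolding * sum_distrib_left
  proof (intro sum.cong refl)
    fix Q
    have U_entry: "?U $$ (bidx n ?b, bidx n Q)
        = (\<Prod>j\<in>{1..n}. Ubasis (fst (r j)) $$ (of_bool (?b j), of_bool (Q j)))"
      by (rule tensor_entry) (rule Ubasis_carrier)
    have "(1 / 3) ^ n * (?U $$ (bidx n ?b, bidx n Q) * cnj (?U $$ (bidx n ?b, bidx n Q)))
      = (\<Prod>j\<in>{1..n}. (1 / 3) * (Ubasis (fst (r j)) $$ (of_bool (?b j), of_bool (Q j)) *
           cnj (Ubasis (fst (r j)) $$ (of_bool (?b j), of_bool (Q j)))))"
      unfolding U_entry prod.distrib by simp
    also have "\<dots> = (\<Prod>j\<in>{1..n}. of_real (shot_weight (Q j) (r j)))"
    proof (rule prod.cong[OF refl])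
      fix j assume "j \<in> {1..n}"
      then have "fst (r j) \<in> {0, 1, 2}"
        using PiE_mem[OF assms[unfolded records_def], of j] by auto
      from Ubasis_abs_sq[OF this, of "?b j" "Q j"]
      show "(1 / 3) * (Ubasis (fst (r j)) $$ (of_bool (?b j), of_bool (Q j)) *
           cnj (Ubasis (fst (r j)) $$ (of_bool (?b j), of_bool (Q j))))
         = of_real (shot_weight (Q j) (r j))" by simp
    qed
    finally show "complex_of_real ((1 / 3) ^ n) *
        (of_real (p Q) * (?U $$ (bidx n ?b, bidx n Q) * cnj (?U $$ (bidx n ?b, bidx n Q))))
      = of_real (p Q * (\<Prod>j\<in>{1..n}. shot_weight (Q j) (r j)))"
      by (simp add: algebra_simps power_divide)
  qed
  from arg_cong[OF this, of Re]
  have "(1 / 3) ^ n * Re ((?U * diag_state n p * dagger ?U) $$ (bidx n ?b, bidx n ?b))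
      = (\<Sum>Q\<in>bitstrings n. p Q * (\<Prod>j\<in>{1..n}. shot_weight (Q j) (r j)))"
    unfolding of_real_sum[symmetric] Re_complex_of_real by (simp del: of_real_power)
  then show ?thesis
    unfolding rec_prob_def Let_def k .
qed

section \<open>Finite product distributions\<close>

text \<open>Finite weighted sums take the place of measures: \<open>snap_Prob\<close> is itself a
  finite sum, so a change of viewpoint becomes a reindexing.\<close>

definition prob_weights :: "'a set \<Rightarrow> ('a \<Rightarrow> real) \<Rightarrow> bool" where
  "prob_weights S w \<longleftrightarrow> finite S \<and> (\<forall>s\<in>S. 0 \<le> w s) \<and> (\<Sum>s\<in>S. w s) = 1"

definition product_weight :: "'i set \<Rightarrow> ('i \<Rightarrow> 'a \<Rightarrow> real) \<Rightarrow> ('i \<Rightarrow> 'a) \<Rightarrow> real" where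
  "product_weight A w y = (\<Prod>i\<in>A. w i (y i))"

definition expect :: "'a set \<Rightarrow> ('a \<Rightarrow> real) \<Rightarrow> ('a \<Rightarrow> real) \<Rightarrow> real" where
  "expect S w f = (\<Sum>s\<in>S. w s * f s)"

lemma expect_const: "prob_weights S w \<Longrightarrow> expect S w (\<lambda>_. c) = c"
  by (simp add: expect_def prob_weights_def flip: sum_distrib_right)

lemma expect_add: "expect S w (\<lambda>s. f s + g s) = expect S w f + expect S w g"
  by (simp add: expect_def distrib_left sum.distrib)

lemma expect_cmult: "expect S w (\<lambda>s. c * f s) = c * expect S w f"
  by (simp add: expect_def sum_distrib_left mult_ac)

lemma expect_diff: "expect S w (\<lambda>s. f s - g s) = expect S w f - expect S w g"
  by (simp add: expect_def right_diff_distrib sum_subtractf)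

lemma expect_sum: "expect S w (\<lambda>s. \<Sum>x\<in>X. f x s) = (\<Sum>x\<in>X. expect S w (f x))"
  unfolding expect_def sum_distrib_left by (rule sum.swap)

lemma expect_mono:
  assumes "prob_weights S w" "\<And>s. s \<in> S \<Longrightarrow> f s \<le> g s"
  shows "expect S w f \<le> expect S w g"
  unfolding expect_def using assms by (intro sum_mono mult_left_mono) (auto simp: prob_weights_def)

lemma expect_cong:
  assumes "\<And>s. s \<in> S \<Longrightarrow> f s = g s"
  shows "expect S w f = expect S w g"
  unfolding expect_def using assms by (intro sum.cong) auto

lemma expect_product:
  assumes "finite A" "finite S"
  shows "expect (A \<rightarrow>\<^sub>E S) (product_weight A w) (\<lambda>y. \<Prod>i\<in>A. g i (y i)) = (\<Prod>i\<in>A. expect S (w i) (g i))"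
proof -
  have "(\<Prod>i\<in>A. expect S (w i) (g i)) = (\<Sum>y\<in>A \<rightarrow>\<^sub>E S. \<Prod>i\<in>A. w i (y i) * g i (y i))"
    unfolding expect_def by (rule prod_sum_PiE) (use assms in auto)
  then show ?thesis by (simp add: expect_def product_weight_def prod.distrib)
qed

lemma prob_weights_product:
  assumes "finite A" "\<And>i. i \<in> A \<Longrightarrow> prob_weights S (w i)" "finite S"
  shows "prob_weights (A \<rightarrow>\<^sub>E S) (product_weight A w)"
proof -
  have "(\<Sum>y\<in>A \<rightarrow>\<^sub>E S. product_weight A w y) = (\<Prod>i\<in>A. expect S (w i) (\<lambda>_. 1))"
    using expect_product[OF assms(1,3), of w "\<lambda>_ _. 1"] by (simp add: expect_def)
  also have "\<dots> = 1" using assms(2) by (simp add: expect_const)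
  finally show ?thesis
    using assms by (auto simp: prob_weights_def product_weight_def PiE_iff intro!: finite_PiE prod_nonneg)
qed

lemma expect_coordinate:
  assumes "finite A" "\<And>i. i \<in> A \<Longrightarrow> prob_weights S (w i)" "finite S" "j \<in> A"
  shows "expect (A \<rightarrow>\<^sub>E S) (product_weight A w) (\<lambda>y. g (y j)) = expect S (w j) g"
proof -
  have "expect (A \<rightarrow>\<^sub>E S) (product_weight A w) (\<lambda>y. g (y j))
      = expect (A \<rightarrow>\<^sub>E S) (product_weight A w) (\<lambda>y. \<Prod>i\<in>A. if i = j then g (y i) else 1)"
    using assms by (intro expect_cong) simp
  also have "\<dots> = (\<Prod>i\<in>A. expect S (w i) (\<lambda>s. if i = j then g s else 1))"
    by (rule expect_product[OF assms(1,3)])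
  also have "\<dots> = (\<Prod>i\<in>A. if i = j then expect S (w i) g else 1)"
    using assms by (intro prod.cong) (auto simp: expect_const)
  finally show ?thesis using assms by simp
qed

text \<open>With identical factors the product weight is invariant under permuting coordinates. This
  supplies the exchangeability of the shots.\<close>

lemma expect_permute:
  assumes "\<pi> permutes A"
  shows "expect (A \<rightarrow>\<^sub>E S) (product_weight A (\<lambda>_. w)) (\<lambda>y. f (y \<circ> \<pi>))
       = expect (A \<rightarrow>\<^sub>E S) (product_weight A (\<lambda>_. w)) f"
  unfolding expect_def
proof (rule sum.reindex_bij_witness[where i = "\<lambda>y. y \<circ> inv_into UNIV \<pi>" and j = "\<lambda>y. y \<circ> \<pi>"])
  have inv: "inv_into UNIV \<pi> permutes A" by (rule permutes_inv[OF assms])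
  have PiE: "y \<circ> p \<in> A \<rightarrow>\<^sub>E S" if "y \<in> A \<rightarrow>\<^sub>E S" "p permutes A" for y p
    using that permutes_in_image[OF that(2)] by (auto simp: PiE_iff extensional_def permutes_not_in)
  show "y \<circ> inv_into UNIV \<pi> \<in> A \<rightarrow>\<^sub>E S" if "y \<in> A \<rightarrow>\<^sub>E S" for y using PiE[OF that inv] .
  show "y \<circ> \<pi> \<in> A \<rightarrow>\<^sub>E S" if "y \<in> A \<rightarrow>\<^sub>E S" for y using PiE[OF that assms] .
  show "y \<circ> \<pi> \<circ> inv_into UNIV \<pi> = y" for y :: "'a \<Rightarrow> 'b" using permutes_inv_o(1)[OF assms] by (simp add: comp_assoc)
  show "y \<circ> inv_into UNIV \<pi> \<circ> \<pi> = y" for y :: "'a \<Rightarrow> 'b" using permutes_inv_o(2)[OF assms] by (simp add: comp_assoc)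
  show "product_weight A (\<lambda>_. w) (y \<circ> \<pi>) * f (y \<circ> \<pi>) = product_weight A (\<lambda>_. w) y * f (y \<circ> \<pi>)" for y
    using prod.permute[OF assms, of "\<lambda>i. w (y i)"] by (simp add: product_weight_def comp_def)
qed

section \<open>One qubit over all shots\<close>

definition cells :: "(bool \<times> nat \<times> bool) set" where
  "cells = UNIV \<times> ({0, 1, 2} \<times> UNIV)"

text \<open>The factor 1/2 is the uniform law of the hidden bit: the \<open>1 / 2 ^ M\<close> of
  \<open>p_hard\<close> is shared out among the first M qubits.\<close>

definition cell_weight :: "bool \<times> nat \<times> bool \<Rightarrow> real" where
  "cell_weight s = shot_weight (fst s) (snd s) / 2"

definition shot_columns :: "nat \<Rightarrow> (nat \<Rightarrow> bool \<times> nat \<times> bool) set" where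
  "shot_columns N = {1..N} \<rightarrow>\<^sub>E cells"

definition column_weight :: "nat \<Rightarrow> (nat \<Rightarrow> bool \<times> nat \<times> bool) \<Rightarrow> real" where
  "column_weight N = product_weight {1..N} (\<lambda>_. cell_weight)"

definition total :: "nat \<Rightarrow> (nat \<Rightarrow> bool \<times> nat \<times> bool) \<Rightarrow> real" where
  "total N c = (\<Sum>k\<in>{1..N}. shot_value (snd (c k)))"

text \<open>The estimate of a qubit is 3 / N times its total, so the threshold 9 / sqrt N turns into
  3 sqrt N.\<close>

definition selected :: "nat \<Rightarrow> (nat \<Rightarrow> bool \<times> nat \<times> bool) \<Rightarrow> bool" where
  "selected N c \<longleftrightarrow> 3 * sqrt (real N) \<le> total N c"

definition selected_prob :: "nat \<Rightarrow> real" where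
  "selected_prob N = expect (shot_columns N) (column_weight N) (\<lambda>c. of_bool (selected N c))"

lemma finite_cells: "finite cells"
  by (simp add: cells_def)

lemma expect_cells:
  "expect cells cell_weight f = (\<Sum>q\<in>UNIV. \<Sum>u\<in>{0, 1, 2}. \<Sum>b\<in>UNIV. cell_weight (q, u, b) * f (q, u, b))"
  by (simp add: expect_def cells_def sum.cartesian_product)

lemma prob_weights_cells: "prob_weights cells cell_weight"
proof -
  have "(\<Sum>s\<in>cells. cell_weight s) = 1"
    using expect_cells[of "\<lambda>_. 1"] by (simp add: expect_def cell_weight_def shot_weight_def UNIV_bool)
  then show ?thesis
    by (auto simp: prob_weights_def finite_cells cell_weight_def shot_weight_def)
qed

lemma prob_weights_columns: "prob_weights (shot_columns N) (column_weight N)"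
  unfolding shot_columns_def column_weight_def
  by (intro prob_weights_product) (auto simp: prob_weights_cells finite_cells)

lemma expect_columns_prod:
  "expect (shot_columns N) (column_weight N) (\<lambda>c. \<Prod>k\<in>{1..N}. g k (c k))
    = (\<Prod>k\<in>{1..N}. expect cells cell_weight (g k))"
  unfolding shot_columns_def column_weight_def by (rule expect_product) (auto simp: finite_cells)

lemma expect_cells_exp_shot:
  "expect cells cell_weight (\<lambda>s. exp (t * shot_value (snd s))) = 2 / 3 + (exp t + exp (- t)) / 6"
  by (simp add: expect_cells UNIV_bool cell_weight_def shot_weight_def shot_value_def)

lemma expect_cells_exp_sign:
  "expect cells cell_weight (\<lambda>s. exp (t * bit_sign (fst s))) = (exp t + exp (- t)) / 2"
  by (simp add: expect_cells UNIV_bool cell_weight_def shot_weight_def bit_sign_def)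

section \<open>Elementary bounds on the exponential function\<close>

lemma exp_le_quadratic:
  fixes x :: real
  assumes "x \<le> 1"
  shows "exp x \<le> 1 + x + x\<^sup>2"
proof (cases "0 \<le> x")
  case True
  then show ?thesis using assms exp_bound by blast
next
  case False
  define y where "y = - x"
  have y: "0 < y" using False by (simp add: y_def)
  \<comment> \<open>For negative arguments the claim is (1 - y + y^2) exp y >= 1, and it already
    holds with exp y replaced by its quadratic Taylor polynomial.\<close>
  have "(1 - y + y\<^sup>2) * (1 + y + y\<^sup>2 / 2) = 1 + (y ^ 2 + y ^ 3 + y ^ 4) / 2"
    by (simp add: eval_nat_numeral field_simps)
  then have "1 \<le> (1 - y + y\<^sup>2) * (1 + y + y\<^sup>2 / 2)"
    using y by simp
  also have "\<dots> \<le> (1 - y + y\<^sup>2) * exp y"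
  proof (rule mult_left_mono)
    show "1 + y + y\<^sup>2 / 2 \<le> exp y" using exp_lower_Taylor_quadratic[of y] y by simp
    have "1 - y + y\<^sup>2 = (y - 1 / 2)\<^sup>2 + 3 / 4" by (simp add: power2_eq_square algebra_simps)
    then show "0 \<le> 1 - y + y\<^sup>2" by simp
  qed
  finally show ?thesis by (simp add: y_def exp_minus field_simps)
qed

text \<open>A form valid for all real \<open>x\<close>, needed because a sum of signs divided by
  sqrt N is not bounded uniformly in N.\<close>

lemma exp_le_remainder:
  fixes x :: real
  shows "exp x \<le> 1 + x + x\<^sup>2 * exp \<bar>x\<bar>"
proof (cases "x \<le> 1")
  case True
  have "x\<^sup>2 * 1 \<le> x\<^sup>2 * exp \<bar>x\<bar>" by (intro mult_left_mono) auto
  then show ?thesis using exp_le_quadratic[OF True] by simp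
next
  case False
  then have "1 * exp x \<le> x\<^sup>2 * exp x" by (intro mult_right_mono one_le_power) auto
  then have "exp x \<le> 1 + x + x\<^sup>2 * exp x" using False by linarith
  then show ?thesis using False by simp
qed

lemma exp_add_exp_minus_le:
  fixes x :: real
  assumes "\<bar>x\<bar> \<le> 1"
  shows "exp x + exp (- x) \<le> 2 + 2 * x\<^sup>2"
proof -
  have "exp x \<le> 1 + x + x\<^sup>2" using assms by (intro exp_le_quadratic) linarith
  moreover have "exp (- x) \<le> 1 + (- x) + (- x)\<^sup>2" using assms by (intro exp_le_quadratic) linarith
  ultimately show ?thesis by simp
qed

lemma exp_add_exp_minus_ge:
  fixes x :: real
  assumes "0 \<le> x"
  shows "2 + x\<^sup>2 \<le> exp x + exp (- x)"
proof -
  \<comment> \<open>The square of 2 sinh (x / 2) is exp x + exp (-x) - 2, so the bound reduces to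
    sinh y >= y.\<close>
  have "x / 2 \<le> (exp (x / 2) - inverse (exp (x / 2))) / 2"
    using assms by (intro real_le_x_sinh) auto
  then have "x \<le> exp (x / 2) - exp (- (x / 2))" by (simp add: exp_minus)
  then have "x\<^sup>2 \<le> (exp (x / 2) - exp (- (x / 2)))\<^sup>2" using assms by (intro power_mono) auto
  also have "\<dots> = exp x + exp (- x) - 2"
    by (simp add: power2_diff flip: exp_double exp_add)
  finally show ?thesis by simp
qed

section \<open>Selection probability, uniformly in the number of shots\<close>

lemma expect_exp_total:
  "expect (shot_columns N) (column_weight N) (\<lambda>c. exp (t * total N c)) = (2 / 3 + (exp t + exp (- t)) / 6) ^ N"
  using expect_columns_prod[of N "\<lambda>_ s. exp (t * shot_value (snd s))"]
  by (simp add: total_def sum_distrib_left exp_sum expect_cells_exp_shot)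

text \<open>One configuration suffices: hidden bit 0 measured in the Z basis in every shot, with
  probability 1/6 per shot. Its total is N, which reaches 3 sqrt N from N = 9 on.\<close>

lemma selected_prob_lower_small:
  assumes "9 \<le> N"
  shows "(1 / 6) ^ N \<le> selected_prob N"
proof -
  have "(1 / 6) ^ N = (\<Prod>k\<in>{1..N}. expect cells cell_weight (\<lambda>s. of_bool (s = (False, 2, False))))"
    by (simp add: expect_cells UNIV_bool cell_weight_def shot_weight_def)
  also have "\<dots> = expect (shot_columns N) (column_weight N) (\<lambda>c. \<Prod>k\<in>{1..N}. of_bool (c k = (False, 2, False)))"
    by (rule expect_columns_prod[symmetric])
  also have "\<dots> \<le> selected_prob N"
    unfolding selected_prob_def
  proof (rule expect_mono[OF prob_weights_columns])
    fix c
    show "(\<Prod>k\<in>{1..N}. of_bool (c k = (False, 2, False))) \<le> (of_bool (selected N c) :: real)"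
    proof (cases "\<forall>k\<in>{1..N}. c k = (False, 2, False)")
      case True
      have "3 * sqrt (real N) \<le> sqrt (real N) * sqrt (real N)"
        using assms by (intro mult_right_mono real_le_rsqrt) auto
      then have "selected N c" using True by (simp add: selected_def total_def shot_value_def)
      then show ?thesis using True by simp
    next
      case False
      then have "(\<Prod>k\<in>{1..N}. of_bool (c k = (False, 2, False))) = (0::real)"
        by (intro prod_zero) auto
      then show ?thesis by (simp del: prod_zero_iff)
    qed
  qed
  finally show ?thesis .
qed

text \<open>A second moment argument for the exponentially tilted variable \<open>exp (40 T / sqrt N)\<close>:
  its mean exceeds the contribution of \<open>T < 3 sqrt N\<close>, while its second moment stays bounded.\<close>

lemma selected_prob_lower_large:
  assumes "6400 \<le> N"
  shows "exp (- 6400 / 3) \<le> selected_prob N"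
proof -
  \<comment> \<open>A tilt a / sqrt N gives \<open>W\<close> a mean of at least exp (a^2 / 12),
    while \<open>W\<close> is at most exp (3 a) off the selection; the mean wins once a > 36. For a
    = 40 the exponents are 1600 / 12 > 133 and 120. The condition 2 t <= 1, used for the second
    moment, is the origin of N >= 6400.\<close>
  define t where "t = 40 / sqrt (real N)"
  define W where "W = (\<lambda>c. exp (t * total N c))"
  define K where "K = exp (6400 / 3 :: real)"
  let ?E = "expect (shot_columns N) (column_weight N)"
  have N: "0 < real N" using assms by simp
  have t_sq: "t\<^sup>2 = 1600 / real N" using N by (simp add: t_def power_divide)
  have "80 \<le> sqrt (real N)" using assms by (intro real_le_rsqrt) auto
  then have t: "0 \<le> t" "2 * t \<le> 1" using N by (simp_all add: t_def divide_simps)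
  have "exp 133 \<le> exp (real N * (t\<^sup>2 / 12))" using N by (simp add: t_sq)
  also have "\<dots> = exp (t\<^sup>2 / 12) ^ N" by (rule exp_of_nat_mult)
  also have "\<dots> \<le> (2 / 3 + (exp t + exp (- t)) / 6) ^ N"
  proof (rule power_mono)
    have "t\<^sup>2 \<le> 1" using t power_le_one[of t 2] by simp
    then have "exp (t\<^sup>2 / 12) \<le> 1 + t\<^sup>2 / 12 + (t\<^sup>2 / 12)\<^sup>2" by (intro exp_le_quadratic) simp
    also have "(t\<^sup>2 / 12)\<^sup>2 \<le> (t\<^sup>2 / 12) * 1"
      unfolding power2_eq_square[of "t\<^sup>2 / 12"] using \<open>t\<^sup>2 \<le> 1\<close> by (intro mult_left_mono) auto
    finally have "exp (t\<^sup>2 / 12) \<le> 1 + t\<^sup>2 / 6" by simp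
    then show "exp (t\<^sup>2 / 12) \<le> 2 / 3 + (exp t + exp (- t)) / 6"
      using exp_add_exp_minus_ge[OF t(1)] by argo
  qed auto
  also have "\<dots> = ?E W" unfolding W_def by (rule expect_exp_total[symmetric])
  finally have lower: "exp 133 \<le> ?E W" .
  have "?E (\<lambda>c. (W c)\<^sup>2) = ?E (\<lambda>c. exp ((2 * t) * total N c))"
    by (simp add: W_def mult.assoc flip: exp_double)
  also have "\<dots> = (2 / 3 + (exp (2 * t) + exp (- (2 * t))) / 6) ^ N" by (rule expect_exp_total)
  also have "\<dots> \<le> exp (4 * t\<^sup>2 / 3) ^ N"
  proof (rule power_mono)
    have "2 / 3 + (exp (2 * t) + exp (- (2 * t))) / 6 \<le> 1 + 4 * t\<^sup>2 / 3"
    proof -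
      have "exp (2 * t) + exp (- (2 * t)) \<le> 2 + 8 * t\<^sup>2"
        using exp_add_exp_minus_le[of "2 * t"] t by (simp add: power_mult_distrib)
      then show ?thesis by argo
    qed
    also have "\<dots> \<le> exp (4 * t\<^sup>2 / 3)" by (rule exp_ge_add_one_self)
    finally show "2 / 3 + (exp (2 * t) + exp (- (2 * t))) / 6 \<le> exp (4 * t\<^sup>2 / 3)" .
  qed (simp add: add_nonneg_nonneg)
  also have "\<dots> = K" using N by (simp add: K_def t_sq flip: exp_of_nat_mult)
  finally have second: "?E (\<lambda>c. (W c)\<^sup>2) \<le> K" .
  \<comment> \<open>A linearised Cauchy-Schwarz inequality: on the selection, W <= K / 4 + W^2 / K
    by the arithmetic-geometric mean. Since \<open>K\<close> bounds the second moment, the last term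
    contributes at most 1.\<close>
  have "?E W \<le> ?E (\<lambda>c. exp 120 + (K / 4 * of_bool (selected N c) + (1 / K) * (W c)\<^sup>2))"
  proof (rule expect_mono[OF prob_weights_columns])
    fix c
    show "W c \<le> exp 120 + (K / 4 * of_bool (selected N c) + (1 / K) * (W c)\<^sup>2)"
    proof (cases "selected N c")
      case True
      have "0 \<le> (W c - K / 2)\<^sup>2 / K" by (simp add: K_def)
      also have "\<dots> = (1 / K) * (W c)\<^sup>2 - W c + K / 4"
        by (simp add: K_def power2_eq_square field_simps)
      finally have "W c \<le> K / 4 * of_bool (selected N c) + (1 / K) * (W c)\<^sup>2" using True by simp
      then show ?thesis by (rule add_increasing[OF exp_ge_zero])
    next
      case False
      then have "t * total N c \<le> t * (3 * sqrt (real N))"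
        using t by (intro mult_left_mono) (auto simp: selected_def)
      also have "\<dots> = 120" using N by (simp add: t_def)
      finally have "W c \<le> exp 120" by (simp add: W_def)
      then show ?thesis using False by (simp add: K_def add_increasing2)
    qed
  qed
  also have "\<dots> = exp 120 + (K / 4 * selected_prob N + (1 / K) * ?E (\<lambda>c. (W c)\<^sup>2))"
    by (simp only: expect_add expect_cmult expect_const[OF prob_weights_columns] selected_prob_def)
  also have "(1 / K) * ?E (\<lambda>c. (W c)\<^sup>2) \<le> (1 / K) * K"
    using second by (intro mult_left_mono) (simp_all add: K_def)
  also have "(1 / K) * K = 1" by (simp add: K_def)
  finally have "exp 133 \<le> exp 120 + K / 4 * selected_prob N + 1" using lower by simp
  moreover have "exp 120 + 1 + 1 \<le> exp (133::real)"
  proof -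
    have "exp (133::real) = exp 120 * exp 13" by (simp flip: exp_add)
    moreover have "exp (120::real) * 3 \<le> exp 120 * exp 13"
      using exp_ge_add_one_self[of "13::real"] by (intro mult_left_mono) auto
    moreover have "1 \<le> exp (120::real)" by simp
    ultimately show ?thesis by linarith
  qed
  ultimately have "4 / K \<le> selected_prob N" by (simp add: K_def field_simps)
  moreover have "exp (- 6400 / 3) = 1 / K" by (simp add: K_def exp_minus inverse_eq_divide)
  moreover have "1 / K \<le> 4 / K" by (rule divide_right_mono) (simp_all add: K_def)
  ultimately show ?thesis by linarith
qed

text \<open>The threshold sits at a fixed multiple of the standard deviation, so the probability
  does not vanish for large N; the finitely many remaining N are absorbed by a crude power of
  1/6.\<close>

lemma selected_prob_lower:
  obtains q where "0 < q" "q \<le> 1" "\<And>N. 9 \<le> N \<Longrightarrow> q \<le> selected_prob N"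
proof
  let ?q = "min ((1 / 6) ^ 6400) (exp (- 6400 / 3)) :: real"
  show "0 < ?q" by simp
  show "?q \<le> 1" by (rule min.coboundedI2) simp
  show "?q \<le> selected_prob N" if "9 \<le> N" for N
  proof (cases "6400 \<le> N")
    case True
    then show ?thesis by (intro min.coboundedI2 selected_prob_lower_large)
  next
    case False
    then have "(1 / 6) ^ 6400 \<le> (1 / 6 :: real) ^ N" by (intro power_decreasing) auto
    also have "\<dots> \<le> selected_prob N" by (rule selected_prob_lower_small[OF that])
    finally show ?thesis by (rule min.coboundedI1)
  qed
qed

text \<open>When shot \<open>k\<close> is not measured in the Z basis, flipping its hidden bit
  changes neither the record nor the weight, hence not the selection either, so these signs cancel
  in pairs and the value is 0 there. In the Z basis sign and value agree wherever the weight is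
  nonzero.\<close>

lemma selected_sign_eq_value:
  assumes "k \<in> {1..N}"
  shows "expect (shot_columns N) (column_weight N) (\<lambda>c. of_bool (selected N c) * bit_sign (fst (c k)))
       = expect (shot_columns N) (column_weight N) (\<lambda>c. of_bool (selected N c) * shot_value (snd (c k)))"
proof -
  define flip where "flip = (\<lambda>s::bool \<times> nat \<times> bool. if fst (snd s) = 2 then s else (\<not> fst s, snd s))"
  define \<phi> where "\<phi> = (\<lambda>c::nat \<Rightarrow> bool \<times> nat \<times> bool. c(k := flip (c k)))"
  define g where "g = (\<lambda>c. column_weight N c *
    (of_bool (selected N c) * bit_sign (fst (c k)) - of_bool (selected N c) * shot_value (snd (c k))))"
  have flip: "flip (flip s) = s" "snd (flip s) = snd s" "cell_weight (flip s) = cell_weight s"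
    "flip s \<in> cells \<longleftrightarrow> s \<in> cells" for s
    by (cases s; auto simp: flip_def cell_weight_def shot_weight_def cells_def)+
  have \<phi>_in: "\<phi> c \<in> shot_columns N" if "c \<in> shot_columns N" for c
    using that assms unfolding \<phi>_def shot_columns_def by (auto simp: PiE_iff extensional_def flip)
  have \<phi>2: "\<phi> (\<phi> c) = c" for c by (simp add: \<phi>_def flip)
  have weight: "column_weight N (\<phi> c) = column_weight N c" for c
    unfolding column_weight_def product_weight_def \<phi>_def by (rule prod.cong) (auto simp: flip)
  have sel: "selected N (\<phi> c) = selected N c" for c
  proof -
    have "total N (\<phi> c) = total N c"
      unfolding total_def \<phi>_def by (rule sum.cong) (auto simp: flip)
    then show ?thesis by (simp add: selected_def)
  qed
  \<comment> \<open>In the Z basis \<phi> fixes \<open>c\<close>, so there the claim amounts to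
    \<open>g c = 0\<close>: either sign and value agree, or the outcome contradicts the hidden bit
    and the weight vanishes.\<close>
  have g: "g (\<phi> c) = - g c" for c
  proof (cases "fst (snd (c k)) = 2")
    case True
    show ?thesis
    proof (cases "fst (c k) = snd (snd (c k))")
      case True
      then show ?thesis using \<open>fst (snd (c k)) = 2\<close>
        by (simp add: g_def \<phi>_def flip_def bit_sign_def shot_value_def)
    next
      case False
      then have "cell_weight (c k) = 0"
        using \<open>fst (snd (c k)) = 2\<close> by (simp add: cell_weight_def shot_weight_def)
      then have "column_weight N c = 0"
        using assms by (auto simp: column_weight_def product_weight_def intro!: prod_zero)
      then show ?thesis using weight[of c] by (simp add: g_def)
    qed
  next
    case False
    then have "bit_sign (fst (\<phi> c k)) = - bit_sign (fst (c k))" "shot_value (snd (\<phi> c k)) = 0"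
      "shot_value (snd (c k)) = 0"
      by (simp_all add: \<phi>_def flip_def bit_sign_def shot_value_def)
    then show ?thesis unfolding g_def weight sel by simp
  qed
  have "(\<Sum>c\<in>shot_columns N. g c) = (\<Sum>c\<in>shot_columns N. g (\<phi> c))"
    by (rule sum.reindex_bij_witness[where i = \<phi> and j = \<phi>]) (auto simp: \<phi>2 \<phi>_in)
  also have "\<dots> = - (\<Sum>c\<in>shot_columns N. g c)" by (simp add: g sum_negf)
  finally have "(\<Sum>c\<in>shot_columns N. g c) = 0" by simp
  then have "expect (shot_columns N) (column_weight N) (\<lambda>c. of_bool (selected N c) * bit_sign (fst (c k))
      - of_bool (selected N c) * shot_value (snd (c k))) = 0"
    by (simp add: g_def expect_def)
  then show ?thesis by (simp add: expect_diff)
qed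

lemma selected_value_symmetric:
  assumes "k \<in> {1..N}" "l \<in> {1..N}"
  shows "expect (shot_columns N) (column_weight N) (\<lambda>c. of_bool (selected N c) * shot_value (snd (c k)))
       = expect (shot_columns N) (column_weight N) (\<lambda>c. of_bool (selected N c) * shot_value (snd (c l)))"
proof -
  let ?\<pi> = "Transposition.transpose k l"
  have \<pi>: "?\<pi> permutes {1..N}" using assms by (rule permutes_swap_id)
  have "total N (c \<circ> ?\<pi>) = total N c" for c
    unfolding total_def using sum.permute[OF \<pi>, of "\<lambda>k. shot_value (snd (c k))"] by (simp add: comp_def)
  then have "selected N (c \<circ> ?\<pi>) = selected N c" for c by (simp add: selected_def)
  then show ?thesis
    unfolding shot_columns_def column_weight_def
    using expect_permute[OF \<pi>, of cells cell_weight "\<lambda>c. of_bool (selected N c) * shot_value (snd (c l))"]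
    by simp
qed

text \<open>On the selection the total is at least 3 sqrt N, and by exchangeability the N shots have
  equal shares in its mean. Conditionally on selection each hidden sign thus has mean at least 3 /
  sqrt N.\<close>

lemma selected_sign_mean:
  assumes "k \<in> {1..N}"
  shows "3 * sqrt (real N) * selected_prob N
    \<le> real N * expect (shot_columns N) (column_weight N) (\<lambda>c. of_bool (selected N c) * bit_sign (fst (c k)))"
proof -
  let ?E = "expect (shot_columns N) (column_weight N)"
  have "3 * sqrt (real N) * selected_prob N = ?E (\<lambda>c. 3 * sqrt (real N) * of_bool (selected N c))"
    by (simp add: selected_prob_def expect_cmult)
  also have "\<dots> \<le> ?E (\<lambda>c. of_bool (selected N c) * total N c)"
    by (rule expect_mono[OF prob_weights_columns]) (simp add: selected_def)
  also have "\<dots> = (\<Sum>l\<in>{1..N}. ?E (\<lambda>c. of_bool (selected N c) * shot_value (snd (c l))))"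
    by (simp only: total_def sum_distrib_left expect_sum)
  also have "\<dots> = (\<Sum>l\<in>{1..N}. ?E (\<lambda>c. of_bool (selected N c) * bit_sign (fst (c k))))"
    using selected_value_symmetric[OF assms] selected_sign_eq_value[OF assms] by (intro sum.cong refl) simp
  finally show ?thesis by simp
qed

section \<open>Exponential moments of the hidden signs\<close>

lemma expect_exp_sign_sum:
  assumes "K \<subseteq> {1..N}"
  shows "expect (shot_columns N) (column_weight N) (\<lambda>c. exp (t * (\<Sum>k\<in>K. bit_sign (fst (c k)))))
       = ((exp t + exp (- t)) / 2) ^ card K"
proof -
  have fin: "finite K" using assms finite_subset by blast
  have *: "(\<Prod>k\<in>{1..N}. if k \<in> K then h k else 1) = (\<Prod>k\<in>K. h k)" for h :: "nat \<Rightarrow> real"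
    using assms by (simp add: prod.If_cases Int_absorb1)
  have "expect (shot_columns N) (column_weight N) (\<lambda>c. exp (t * (\<Sum>k\<in>K. bit_sign (fst (c k)))))
      = expect (shot_columns N) (column_weight N)
          (\<lambda>c. \<Prod>k\<in>{1..N}. if k \<in> K then exp (t * bit_sign (fst (c k))) else 1)"
    unfolding * by (simp add: sum_distrib_left exp_sum fin)
  also have "\<dots> = (\<Prod>k\<in>{1..N}. expect cells cell_weight (\<lambda>s. if k \<in> K then exp (t * bit_sign (fst s)) else 1))"
    by (rule expect_columns_prod)
  also have "\<dots> = (\<Prod>k\<in>{1..N}. if k \<in> K then (exp t + exp (- t)) / 2 else 1)"
    by (intro prod.cong refl) (simp add: expect_cells_exp_sign expect_const[OF prob_weights_cells])
  also have "\<dots> = ((exp t + exp (- t)) / 2) ^ card K"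
    unfolding * by simp
  finally show ?thesis .
qed

text \<open>The sum over \<open>K\<close> fluctuates on the scale \<open>sqrt N\<close> and, restricted to the selection event, has
  mean of that order; hence the tilt \<open>\<beta> / sqrt N\<close> gains a factor independent of \<open>N\<close>.\<close>

lemma expect_exp_selected_signs:
  assumes N: "4 \<le> N" and K: "K \<subseteq> {1..N}" "\<epsilon> * real N \<le> real (card K)"
    and q: "q \<le> selected_prob N" and pos: "0 \<le> \<beta>" "\<beta> \<le> 1" "0 \<le> \<epsilon>" "0 \<le> q"
  shows "expect (shot_columns N) (column_weight N)
      (\<lambda>c. exp (- (\<beta> / sqrt (real N) * (of_bool (selected N c) * (\<Sum>k\<in>K. bit_sign (fst (c k)))))))
    \<le> 1 - 3 * \<beta> * \<epsilon> * q + 4 * exp 4 * \<beta>\<^sup>2"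
proof -
  let ?E = "expect (shot_columns N) (column_weight N)"
  let ?r = "sqrt (real N)"
  define S where "S = (\<lambda>c::nat \<Rightarrow> bool \<times> nat \<times> bool. \<Sum>k\<in>K. bit_sign (fst (c k)))"
  have r: "2 \<le> ?r" "?r * ?r = real N" using N by (auto intro: real_le_rsqrt)
  have cardK: "card K \<le> N" using card_mono[OF _ K(1)] by simp
  \<comment> \<open>The linear term keeps the selection indicator, since it carries the gain. The
    remainder is dominated without it, using v^2 <= 2 exp |v|, so that only exponential moments of
    the unconditioned fair signs remain.\<close>
  have pointwise: "exp (- (\<beta> / ?r * (of_bool (selected N c) * S c)))
      \<le> 1 - \<beta> / ?r * (of_bool (selected N c) * S c)
        + 2 * \<beta>\<^sup>2 * (exp (2 / ?r * S c) + exp (- 2 / ?r * S c))" for c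
  proof -
    define v where "v = S c / ?r"
    define x where "x = - (\<beta> * (of_bool (selected N c) * v))"
    have "\<bar>x\<bar> \<le> \<beta> * \<bar>v\<bar>" using pos by (auto simp: x_def abs_mult)
    moreover have "\<beta> * \<bar>v\<bar> \<le> 1 * \<bar>v\<bar>" using pos by (intro mult_right_mono) auto
    ultimately have x: "\<bar>x\<bar> \<le> \<beta> * \<bar>v\<bar>" "\<bar>x\<bar> \<le> \<bar>v\<bar>" by auto
    have "x\<^sup>2 \<le> (\<beta> * \<bar>v\<bar>)\<^sup>2" using x(1) by (simp add: power2_le_iff_abs_le pos)
    then have "x\<^sup>2 * exp \<bar>x\<bar> \<le> (\<beta> * \<bar>v\<bar>)\<^sup>2 * exp \<bar>v\<bar>" using x(2) by (intro mult_mono) auto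
    also have "\<dots> = \<beta>\<^sup>2 * (v\<^sup>2 * exp \<bar>v\<bar>)" by (simp add: power_mult_distrib)
    also have "\<dots> \<le> \<beta>\<^sup>2 * ((2 * exp \<bar>v\<bar>) * exp \<bar>v\<bar>)"
      using exp_lower_Taylor_quadratic[of "\<bar>v\<bar>"]
      by (intro mult_left_mono mult_right_mono) (auto simp: abs_ge_zero)
    also have "(2 * exp \<bar>v\<bar>) * exp \<bar>v\<bar> = 2 * exp (2 * \<bar>v\<bar>)" by (simp flip: exp_add)
    also have "exp (2 * \<bar>v\<bar>) \<le> exp (2 * v) + exp (- 2 * v)" by (cases "0 \<le> v") auto
    finally have "x\<^sup>2 * exp \<bar>x\<bar> \<le> \<beta>\<^sup>2 * (2 * (exp (2 * v) + exp (- 2 * v)))"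
      by (simp add: mult_left_mono)
    then have "exp x \<le> 1 + x + 2 * \<beta>\<^sup>2 * (exp (2 * v) + exp (- 2 * v))"
      using exp_le_remainder[of x] by argo
    then show ?thesis by (simp add: x_def v_def)
  qed
  \<comment> \<open>Applied with t = 2 / sqrt N and its negative; N >= 4 gives |t| <= 1. The bound
    is independent of N and of \<open>K\<close>.\<close>
  have mgf: "?E (\<lambda>c. exp (t * S c)) \<le> exp 4" if "t\<^sup>2 = 4 / real N" "\<bar>t\<bar> \<le> 1" for t
  proof -
    have "?E (\<lambda>c. exp (t * S c)) = ((exp t + exp (- t)) / 2) ^ card K"
      unfolding S_def by (rule expect_exp_sign_sum[OF K(1)])
    also have "\<dots> \<le> exp (t\<^sup>2) ^ card K"
    proof (rule power_mono)
      have "(exp t + exp (- t)) / 2 \<le> 1 + t\<^sup>2" using exp_add_exp_minus_le[OF that(2)] by simp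
      also have "\<dots> \<le> exp (t\<^sup>2)" by (rule exp_ge_add_one_self)
      finally show "(exp t + exp (- t)) / 2 \<le> exp (t\<^sup>2)" .
    qed (simp add: add_nonneg_nonneg)
    also have "\<dots> \<le> exp (t\<^sup>2) ^ N" using cardK by (intro power_increasing) auto
    also have "\<dots> = exp 4" using N by (simp add: that(1) flip: exp_of_nat_mult)
    finally show ?thesis .
  qed
  \<comment> \<open>Every shot in \<open>K\<close> adds a drift of at least 3 q / N after division
    by sqrt N, and \<open>K\<close> has at least \<epsilon> N shots.\<close>
  have "\<epsilon> * (3 * q) \<le> real (card K) / real N * (3 * selected_prob N)"
    using K(2) q pos N by (intro mult_mono) (auto simp: field_simps)
  also have "\<dots> = (\<Sum>k\<in>K. 3 * selected_prob N / real N)" by simp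
  also have "\<dots> \<le> (\<Sum>k\<in>K. ?E (\<lambda>c. of_bool (selected N c) * bit_sign (fst (c k))) / ?r)"
  proof (rule sum_mono)
    fix k assume "k \<in> K"
    then have "k \<in> {1..N}" using K(1) by blast
    from selected_sign_mean[OF this]
    have "?r * (3 * selected_prob N) \<le> ?r * (?r * ?E (\<lambda>c. of_bool (selected N c) * bit_sign (fst (c k))))"
      unfolding mult.assoc[symmetric] r(2) by (simp only: mult_ac)
    then have "3 * selected_prob N \<le> ?r * ?E (\<lambda>c. of_bool (selected N c) * bit_sign (fst (c k)))"
      using r(1) N by (elim mult_left_le_imp_le) simp
    then have "3 * selected_prob N / real N
        \<le> ?r * ?E (\<lambda>c. of_bool (selected N c) * bit_sign (fst (c k))) / real N"
      by (rule divide_right_mono) simp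
    moreover have "a * x / n = x / a" if "a * a = n" "2 \<le> a" for a x n :: real
      using that by auto
    ultimately show "3 * selected_prob N / real N \<le> ?E (\<lambda>c. of_bool (selected N c) * bit_sign (fst (c k))) / ?r"
      using r by simp
  qed
  also have "\<dots> = ?E (\<lambda>c. of_bool (selected N c) * S c) / ?r"
    by (simp add: S_def sum_distrib_left expect_sum sum_divide_distrib)
  finally have mean: "3 * \<epsilon> * q \<le> ?E (\<lambda>c. of_bool (selected N c) * S c) / ?r" by simp
  have "?E (\<lambda>c. exp (- (\<beta> / ?r * (of_bool (selected N c) * S c))))
      \<le> ?E (\<lambda>c. 1 - \<beta> / ?r * (of_bool (selected N c) * S c)
        + 2 * \<beta>\<^sup>2 * (exp (2 / ?r * S c) + exp (- 2 / ?r * S c)))"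
    by (rule expect_mono[OF prob_weights_columns pointwise])
  also have "\<dots> = 1 - \<beta> * (?E (\<lambda>c. of_bool (selected N c) * S c) / ?r)
      + 2 * \<beta>\<^sup>2 * (?E (\<lambda>c. exp (2 / ?r * S c)) + ?E (\<lambda>c. exp (- 2 / ?r * S c)))"
    unfolding expect_add expect_diff expect_cmult expect_const[OF prob_weights_columns] by simp
  also have "\<dots> \<le> 1 - \<beta> * (3 * \<epsilon> * q) + 2 * \<beta>\<^sup>2 * (exp 4 + exp 4)"
    using mean pos r N
    by (intro add_mono diff_mono mult_left_mono mgf) (auto simp: power_divide)
  finally show ?thesis by (simp add: S_def algebra_simps)
qed

section \<open>Tables of independent columns\<close>

lemma sum_bit_sign:
  assumes "finite I"
  shows "(\<Sum>i\<in>I. bit_sign (Q i)) = real (card I) - 2 * real (card {i \<in> I. Q i})"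
proof -
  have "(\<Sum>i\<in>I. bit_sign (Q i)) = (\<Sum>i\<in>I. 1 - 2 * of_bool (Q i))"
    by (rule sum.cong) (auto simp: bit_sign_def)
  also have "\<dots> = real (card I) - 2 * (\<Sum>i\<in>I. of_bool (Q i))"
    by (simp add: sum_subtractf sum_distrib_left)
  also have "(\<Sum>i\<in>I. of_bool (Q i)) = real (card {i \<in> I. Q i})"
    using assms by (simp add: of_bool_def sum.If_cases Int_def)
  finally show ?thesis .
qed

definition tables :: "nat \<Rightarrow> nat \<Rightarrow> (nat \<Rightarrow> nat \<Rightarrow> bool \<times> nat \<times> bool) set" where
  "tables M N = {1..M} \<rightarrow>\<^sub>E shot_columns N"

definition table_weight :: "nat \<Rightarrow> nat \<Rightarrow> (nat \<Rightarrow> nat \<Rightarrow> bool \<times> nat \<times> bool) \<Rightarrow> real" where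
  "table_weight M N = product_weight {1..M} (\<lambda>_. column_weight N)"

definition selection :: "nat \<Rightarrow> nat \<Rightarrow> (nat \<Rightarrow> nat \<Rightarrow> bool \<times> nat \<times> bool) \<Rightarrow> nat set" where
  "selection M N y = {i \<in> {1..M}. selected N (y i)}"

text \<open>The shots in which the finally queried qubit has hidden bit 1, so that its Z value is -1
  instead of 1.\<close>

definition bad_shots :: "nat \<Rightarrow> nat \<Rightarrow> (nat \<Rightarrow> nat \<Rightarrow> bool \<times> nat \<times> bool) \<Rightarrow> nat set" where
  "bad_shots M N y = {k \<in> {1..N}. maj (selection M N y) (\<lambda>i. fst (y i k))}"

lemma finite_shot_columns: "finite (shot_columns N)"
  using prob_weights_columns by (simp add: prob_weights_def)

lemma prob_weights_tables: "prob_weights (tables M N) (table_weight M N)"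
  unfolding tables_def table_weight_def
  by (intro prob_weights_product) (auto simp: prob_weights_columns finite_shot_columns)

lemma expect_tables_prod:
  "expect (tables M N) (table_weight M N) (\<lambda>y. \<Prod>i\<in>{1..M}. g (y i))
    = expect (shot_columns N) (column_weight N) g ^ M"
  unfolding tables_def table_weight_def
  by (subst expect_product) (simp_all add: finite_shot_columns)

text \<open>A Chernoff bound for the number of selected qubits with parameter -1: since exp (-1) <=
  1/2, each qubit contributes a factor of at most 1 - q / 2.\<close>

lemma few_selected_prob:
  assumes "q \<le> selected_prob N"
  shows "expect (tables M N) (table_weight M N) (\<lambda>y. of_bool (card (selection M N y) < L))
    \<le> exp (real L) * exp (- (real M * q / 2))"
proof -
  let ?g = "\<lambda>c. exp (- of_bool (selected N c)) :: real"
  have "expect (tables M N) (table_weight M N) (\<lambda>y. of_bool (card (selection M N y) < L))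
      \<le> expect (tables M N) (table_weight M N) (\<lambda>y. exp (real L) * (\<Prod>i\<in>{1..M}. ?g (y i)))"
  proof (rule expect_mono[OF prob_weights_tables])
    fix y
    have "(\<Sum>i\<in>{1..M}. of_bool (selected N (y i))) = real (card (selection M N y))"
      by (simp add: selection_def of_bool_def sum.If_cases Int_def)
    then have "(\<Prod>i\<in>{1..M}. ?g (y i)) = exp (- real (card (selection M N y)))"
      by (simp flip: exp_sum add: sum_negf)
    then have "exp (real L) * (\<Prod>i\<in>{1..M}. ?g (y i)) = exp (real L - real (card (selection M N y)))"
      by (simp flip: exp_add)
    then show "of_bool (card (selection M N y) < L) \<le> exp (real L) * (\<Prod>i\<in>{1..M}. ?g (y i))"
      by (auto simp: of_bool_def)
  qed
  also have "\<dots> = exp (real L) * expect (shot_columns N) (column_weight N) ?g ^ M"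
    using expect_tables_prod[of M N ?g] by (simp add: expect_cmult)
  also have "\<dots> \<le> exp (real L) * exp (- (q / 2)) ^ M"
  proof (intro mult_left_mono power_mono)
    have "expect (shot_columns N) (column_weight N) ?g
        \<le> expect (shot_columns N) (column_weight N) (\<lambda>c. 1 - 1 / 2 * of_bool (selected N c))"
    proof (rule expect_mono[OF prob_weights_columns])
      fix c
      have "2 \<le> exp (1::real)" using exp_ge_add_one_self[of 1] by simp
      then show "?g c \<le> 1 - 1 / 2 * of_bool (selected N c)"
        by (cases "selected N c") (simp_all add: exp_minus field_simps)
    qed
    also have "\<dots> = 1 - 1 / 2 * selected_prob N"
      by (simp only: expect_diff expect_cmult expect_const[OF prob_weights_columns] selected_prob_def)
    also have "\<dots> \<le> 1 + - (q / 2)" using assms by simp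
    also have "\<dots> \<le> exp (- (q / 2))" by (rule exp_ge_add_one_self)
    finally show "expect (shot_columns N) (column_weight N) ?g \<le> exp (- (q / 2))" .
    have "expect (shot_columns N) (column_weight N) (\<lambda>_. 0) \<le> expect (shot_columns N) (column_weight N) ?g"
      by (rule expect_mono[OF prob_weights_columns]) simp
    then show "0 \<le> expect (shot_columns N) (column_weight N) ?g"
      by (simp add: expect_const[OF prob_weights_columns])
  qed simp
  also have "\<dots> = exp (real L) * exp (- (real M * q / 2))"
    by (simp flip: exp_of_nat_mult)
  finally show ?thesis .
qed

text \<open>A union bound over the sets \<open>K\<close> of bad shots, not over single shots: for a single shot the
  failure probability is only a constant when \<open>M\<close> is of order \<open>N\<close>, but for a fixed \<open>K\<close> with
  \<open>\<epsilon> N\<close> elements it is exponentially small in \<open>M\<close>, which beats the number \<open>2 ^ N\<close> of sets.\<close>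

lemma many_bad_prob:
  assumes N: "4 \<le> N" and q: "0 \<le> q" "q \<le> 1" "q \<le> selected_prob N" and \<epsilon>: "0 \<le> \<epsilon>" "\<epsilon> \<le> 1"
  shows "expect (tables M N) (table_weight M N) (\<lambda>y. of_bool (\<epsilon> * real N \<le> real (card (bad_shots M N y))))
    \<le> 2 ^ N * exp (- (real M * ((\<epsilon> * q)\<^sup>2 / (2 * exp 4))))"
proof -
  let ?E = "expect (tables M N) (table_weight M N)"
  \<comment> \<open>Close to the minimiser of the quadratic in \<beta> from
    \<open>expect_exp_selected_signs\<close>; with e = \<epsilon> q, the terms -3 \<beta> e and 4
    exp 4 \<beta>^2 add up to exactly -\<gamma>.\<close>
  define \<beta> where "\<beta> = \<epsilon> * q / (2 * exp 4)"
  define \<gamma> where "\<gamma> = (\<epsilon> * q)\<^sup>2 / (2 * exp 4)"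
  define h where "h = (\<lambda>K c. exp (- (\<beta> / sqrt (real N) *
     (of_bool (selected N c) * (\<Sum>k\<in>K. bit_sign (fst (c k :: bool \<times> nat \<times> bool)))))))"
  define \<K> where "\<K> = {K \<in> Pow {1..N}. \<epsilon> * real N \<le> real (card K)}"
  have fin: "finite \<K>" by (simp add: \<K>_def)
  have "\<epsilon> * q \<le> 1 * 1" using q \<epsilon> by (intro mult_mono) auto
  also have "\<dots> \<le> 2 * exp (4::real)"
    using exp_ge_add_one_self[of "4::real"] by simp
  finally have \<beta>: "0 \<le> \<beta>" "\<beta> \<le> 1" using q \<epsilon> by (auto simp: \<beta>_def)
  have \<gamma>: "1 - 3 * \<beta> * \<epsilon> * q + 4 * exp 4 * \<beta>\<^sup>2 = 1 + - \<gamma>"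
    by (simp add: \<beta>_def \<gamma>_def power2_eq_square field_simps)
  have "?E (\<lambda>y. of_bool (\<epsilon> * real N \<le> real (card (bad_shots M N y))))
      \<le> ?E (\<lambda>y. \<Sum>K\<in>\<K>. \<Prod>i\<in>{1..M}. h K (y i))"
  proof (rule expect_mono[OF prob_weights_tables])
    fix y
    let ?I = "selection M N y" and ?K = "bad_shots M N y"
    have nonneg: "0 \<le> (\<Prod>i\<in>{1..M}. h K (y i))" for K
      by (rule prod_nonneg) (simp add: h_def)
    show "of_bool (\<epsilon> * real N \<le> real (card ?K)) \<le> (\<Sum>K\<in>\<K>. \<Prod>i\<in>{1..M}. h K (y i))"
    proof (cases "\<epsilon> * real N \<le> real (card ?K)")
      case True
      have "finite ?I" by (simp add: selection_def)
      \<comment> \<open>For \<open>K\<close> equal to the actual set of bad shots, exchanging the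
        sums shows that the signs over the selection sum to at most 0 in each shot of
        \<open>K\<close>. That summand of the union bound is then at least 1.\<close>
      have "(\<Sum>i\<in>{1..M}. of_bool (selected N (y i)) * (\<Sum>k\<in>?K. bit_sign (fst (y i k))))
          = (\<Sum>i\<in>?I. \<Sum>k\<in>?K. bit_sign (fst (y i k)))"
        unfolding selection_def by (rule sum.mono_neutral_cong_right) auto
      also have "\<dots> = (\<Sum>k\<in>?K. \<Sum>i\<in>?I. bit_sign (fst (y i k)))" by (rule sum.swap)
      also have "\<dots> \<le> 0"
      proof (rule sum_nonpos)
        fix k assume "k \<in> ?K"
        then have "card ?I < 2 * card {i \<in> ?I. fst (y i k)}"
          by (auto simp: bad_shots_def maj_def split: if_splits)
        then show "(\<Sum>i\<in>?I. bit_sign (fst (y i k))) \<le> 0"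
          using sum_bit_sign[OF \<open>finite ?I\<close>, of "\<lambda>i. fst (y i k)"] by linarith
      qed
      finally have le: "\<beta> / sqrt (real N) * (\<Sum>i\<in>{1..M}. of_bool (selected N (y i)) * (\<Sum>k\<in>?K. bit_sign (fst (y i k)))) \<le> 0"
        using \<beta>(1) by (intro mult_nonneg_nonpos) auto
      have "(\<Prod>i\<in>{1..M}. h ?K (y i)) = exp (- (\<beta> / sqrt (real N) *
          (\<Sum>i\<in>{1..M}. of_bool (selected N (y i)) * (\<Sum>k\<in>?K. bit_sign (fst (y i k))))))"
        by (simp add: h_def sum_distrib_left sum_negf flip: exp_sum)
      then have "1 \<le> (\<Prod>i\<in>{1..M}. h ?K (y i))" using le by simp
      also have "\<dots> \<le> (\<Sum>K\<in>\<K>. \<Prod>i\<in>{1..M}. h K (y i))"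
        using True fin nonneg by (intro member_le_sum) (auto simp: \<K>_def bad_shots_def)
      finally show ?thesis using True by simp
    next
      case False
      then show ?thesis using nonneg by (simp add: sum_nonneg)
    qed
  qed
  also have "\<dots> = (\<Sum>K\<in>\<K>. expect (shot_columns N) (column_weight N) (h K) ^ M)"
    unfolding expect_sum by (intro sum.cong refl expect_tables_prod)
  also have "\<dots> \<le> (\<Sum>K\<in>\<K>. exp (- \<gamma>) ^ M)"
  proof (intro sum_mono power_mono)
    fix K assume "K \<in> \<K>"
    then have K: "K \<subseteq> {1..N}" "\<epsilon> * real N \<le> real (card K)" by (auto simp: \<K>_def)
    have "expect (shot_columns N) (column_weight N) (h K) \<le> 1 + - \<gamma>"
      using expect_exp_selected_signs[OF N K q(3) \<beta> \<epsilon>(1) q(1)] unfolding \<gamma> h_def .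
    also have "\<dots> \<le> exp (- \<gamma>)" by (rule exp_ge_add_one_self)
    finally show "expect (shot_columns N) (column_weight N) (h K) \<le> exp (- \<gamma>)" .
    have "expect (shot_columns N) (column_weight N) (\<lambda>_. 0) \<le> expect (shot_columns N) (column_weight N) (h K)"
      by (rule expect_mono[OF prob_weights_columns]) (simp add: h_def)
    then show "0 \<le> expect (shot_columns N) (column_weight N) (h K)"
      by (simp add: expect_const[OF prob_weights_columns])
  qed
  also have "\<dots> = real (card \<K>) * exp (- (real M * \<gamma>))"
    by (simp flip: exp_of_nat_mult)
  also have "\<dots> \<le> 2 ^ N * exp (- (real M * \<gamma>))"
  proof (rule mult_right_mono)
    have "card \<K> \<le> card (Pow {1..N})" by (rule card_mono) (auto simp: \<K>_def)
    then have "card \<K> \<le> 2 ^ N" by (simp add: card_Pow)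
    then show "real (card \<K>) \<le> 2 ^ N" by (metis of_nat_le_iff of_nat_numeral of_nat_power)
  qed simp
  finally show ?thesis by (simp add: \<gamma>_def)
qed

section \<open>Deviation of the final query\<close>

definition rec_cells :: "(nat \<times> bool) set" where
  "rec_cells = {0, 1, 2} \<times> UNIV"

lemma finite_rec_cells: "finite rec_cells"
  by (simp add: rec_cells_def)

lemma expect_rec_cells:
  "expect rec_cells (shot_weight q) f = (\<Sum>u\<in>{0, 1, 2}. \<Sum>b\<in>UNIV. shot_weight q (u, b) * f (u, b))"
  unfolding expect_def rec_cells_def sum.cartesian_product by (rule sum.cong) auto

lemma prob_weights_rec_cells: "prob_weights rec_cells (shot_weight q)"
proof -
  have "(\<Sum>s\<in>rec_cells. shot_weight q s) = 1"
    using expect_rec_cells[of q "\<lambda>_. 1"] by (cases q) (simp_all add: expect_def shot_weight_def UNIV_bool)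
  then show ?thesis by (auto simp: prob_weights_def finite_rec_cells shot_weight_def)
qed

text \<open>Given the hidden majorities \<open>m\<close>, the sum has mean at least 0.998 N / 3,
  whereas 991/3000 is 0.991 / 3. The gap is linear in N, so a Chernoff bound applies.\<close>

lemma majority_deviation:
  fixes m :: "nat \<Rightarrow> bool"
  assumes "real (card {k \<in> {1..N}. m k}) \<le> real N / 1000"
  shows "expect ({1..N} \<rightarrow>\<^sub>E rec_cells) (product_weight {1..N} (\<lambda>k. shot_weight (m k)))
      (\<lambda>c. of_bool ((\<Sum>k\<in>{1..N}. shot_value (c k)) < 991 / 3000 * real N)) \<le> exp (- (real N / 250000))"
proof -
  let ?E = "expect ({1..N} \<rightarrow>\<^sub>E rec_cells) (product_weight {1..N} (\<lambda>k. shot_weight (m k)))"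
  \<comment> \<open>Per shot the exponent is at most (l / 3) (0.991 + l - 1 + 0.002) = (l / 3) (l -
    0.007), and l = 0.004 makes it -1/250000.\<close>
  define l where "l = (1 / 250 :: real)"
  let ?a = "l * (991 / 3000)"
  have pw: "prob_weights ({1..N} \<rightarrow>\<^sub>E rec_cells) (product_weight {1..N} (\<lambda>k. shot_weight (m k)))"
    by (intro prob_weights_product) (auto simp: prob_weights_rec_cells finite_rec_cells)
  have local_bound: "expect rec_cells (shot_weight b) (\<lambda>s. exp (?a - l * shot_value s))
      \<le> exp (?a + (l\<^sup>2 - l) / 3 + 2 * l / 3 * of_bool b)" for b
  proof -
    have "expect rec_cells (shot_weight b) (\<lambda>s. exp (?a - l * shot_value s))
        = exp ?a * expect rec_cells (shot_weight b) (\<lambda>s. exp (- (l * shot_value s)))"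
      by (simp add: expect_cmult[symmetric] flip: exp_add)
    also have "expect rec_cells (shot_weight b) (\<lambda>s. exp (- (l * shot_value s)))
        = 2 / 3 + exp (if b then l else - l) / 3"
      by (cases b) (simp_all add: expect_rec_cells UNIV_bool shot_weight_def shot_value_def)
    also have "\<dots> \<le> 1 + ((l\<^sup>2 - l) / 3 + 2 * l / 3 * of_bool b)"
      using exp_le_quadratic[of l] exp_le_quadratic[of "- l"] by (simp add: l_def power2_eq_square)
    also have "\<dots> \<le> exp ((l\<^sup>2 - l) / 3 + 2 * l / 3 * of_bool b)" by (rule exp_ge_add_one_self)
    finally show ?thesis by (simp flip: exp_add add: add.assoc)
  qed
  have "?E (\<lambda>c. of_bool ((\<Sum>k\<in>{1..N}. shot_value (c k)) < 991 / 3000 * real N))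
      \<le> ?E (\<lambda>c. \<Prod>k\<in>{1..N}. exp (?a - l * shot_value (c k)))"
  proof (rule expect_mono[OF pw])
    fix c
    have "(\<Prod>k\<in>{1..N}. exp (?a - l * shot_value (c k)))
        = exp (l * (991 / 3000 * real N - (\<Sum>k\<in>{1..N}. shot_value (c k))))"
      by (simp add: sum_subtractf sum_distrib_left right_diff_distrib flip: exp_sum)
    then show "of_bool ((\<Sum>k\<in>{1..N}. shot_value (c k)) < 991 / 3000 * real N)
        \<le> (\<Prod>k\<in>{1..N}. exp (?a - l * shot_value (c k)))"
      by (auto simp: of_bool_def l_def)
  qed
  also have "\<dots> = (\<Prod>k\<in>{1..N}. expect rec_cells (shot_weight (m k)) (\<lambda>s. exp (?a - l * shot_value s)))"
    by (rule expect_product) (auto simp: finite_rec_cells)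
  also have "\<dots> \<le> (\<Prod>k\<in>{1..N}. exp (?a + (l\<^sup>2 - l) / 3 + 2 * l / 3 * of_bool (m k)))"
  proof (intro prod_mono conjI local_bound)
    fix k
    have "expect rec_cells (shot_weight (m k)) (\<lambda>_. 0) \<le> expect rec_cells (shot_weight (m k)) (\<lambda>s. exp (?a - l * shot_value s))"
      by (rule expect_mono[OF prob_weights_rec_cells]) simp
    then show "0 \<le> expect rec_cells (shot_weight (m k)) (\<lambda>s. exp (?a - l * shot_value s))"
      by (simp add: expect_const[OF prob_weights_rec_cells])
  qed
  also have "\<dots> = exp (real N * (?a + (l\<^sup>2 - l) / 3) + 2 * l / 3 * real (card {k \<in> {1..N}. m k}))"
  proof -
    have "(\<Sum>k\<in>{1..N}. of_bool (m k)) = real (card {k \<in> {1..N}. m k})"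
      by (simp add: of_bool_def sum.If_cases Int_def)
    then show ?thesis by (simp only: exp_sum[symmetric] finite_atLeastAtMost sum.distrib sum_constant card_atLeastAtMost flip: sum_distrib_left) (simp add: algebra_simps)
  qed
  also have "\<dots> \<le> exp (- (real N / 250000))"
    using assms by (simp add: l_def power2_eq_square)
  finally show ?thesis .
qed

text \<open>If the queried qubit is never measured in the Z basis, its estimate is 0. This is the
  event used when N is too small for any selection: the true expectation is then 1.\<close>

lemma all_unmeasured_prob:
  "(2 / 3) ^ N \<le> expect ({1..N} \<rightarrow>\<^sub>E rec_cells) (product_weight {1..N} (\<lambda>k. shot_weight False))
      (\<lambda>c. of_bool ((\<Sum>k\<in>{1..N}. shot_value (c k)) = 0))"
proof -
  let ?E = "expect ({1..N} \<rightarrow>\<^sub>E rec_cells) (product_weight {1..N} (\<lambda>k. shot_weight False))"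
  have pw: "prob_weights ({1..N} \<rightarrow>\<^sub>E rec_cells) (product_weight {1..N} (\<lambda>k. shot_weight False))"
    by (intro prob_weights_product) (auto simp: prob_weights_rec_cells finite_rec_cells)
  have "(2 / 3) ^ N = (\<Prod>k\<in>{1..N}. expect rec_cells (shot_weight False) (\<lambda>s. of_bool (fst s \<noteq> 2)))"
    by (simp add: expect_rec_cells UNIV_bool shot_weight_def)
  also have "\<dots> = ?E (\<lambda>c. \<Prod>k\<in>{1..N}. of_bool (fst (c k) \<noteq> 2))"
    by (rule expect_product[symmetric]) (auto simp: finite_rec_cells)
  also have "\<dots> \<le> ?E (\<lambda>c. of_bool ((\<Sum>k\<in>{1..N}. shot_value (c k)) = 0))"
  proof (rule expect_mono[OF pw])
    fix c :: "nat \<Rightarrow> nat \<times> bool"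
    show "(\<Prod>k\<in>{1..N}. of_bool (fst (c k) \<noteq> 2)) \<le> (of_bool ((\<Sum>k\<in>{1..N}. shot_value (c k)) = 0) :: real)"
    proof (cases "\<forall>k\<in>{1..N}. fst (c k) \<noteq> 2")
      case True
      then show ?thesis by (simp add: shot_value_def)
    next
      case False
      then have "(\<Prod>k\<in>{1..N}. of_bool (fst (c k) \<noteq> 2)) = (0::real)" by (intro prod_zero) auto
      then show ?thesis by (simp del: prod_zero_iff)
    qed
  qed
  finally show ?thesis .
qed

section \<open>The mean of the majority sign\<close>

text \<open>The bound 4^a / sqrt (2 a + 1) on the central binomial coefficient, squared to stay in
  the naturals. The induction uses the ratio 2 (2 a + 1) / (a + 1) of successive coefficients and (2
  a + 1) (2 a + 3) <= 4 (a + 1)^2.\<close>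

lemma central_binomial_sq_le: "(2 * a choose a)\<^sup>2 * (2 * a + 1) \<le> 16 ^ a"
proof (induction a)
  case 0
  then show ?case by simp
next
  case (Suc a)
  define B where "B = (2 * a choose a)"
  define C where "C = (2 * Suc a choose Suc a)"
  have C: "Suc a * C = 2 * (2 * a + 1) * B"
  proof -
    define D where "D = (2 * a + 1 choose a)"
    have "Suc a * C = Suc a * (2 * D)"
      using Suc_times_binomial[of a "2 * a + 1"] by (simp add: C_def D_def)
    then have "C = 2 * D" by (subst (asm) mult_cancel1) simp
    moreover have "D = (2 * a + 1 choose (a + 1))"
      using binomial_symmetric[of a "2 * a + 1"] by (simp add: D_def)
    then have "Suc a * D = (2 * a + 1) * B"
      using Suc_times_binomial[of a "2 * a"] by (simp add: B_def)
    ultimately show ?thesis by simp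
  qed
  have "(Suc a)\<^sup>2 * (C\<^sup>2 * (2 * Suc a + 1)) = (Suc a * C)\<^sup>2 * (2 * a + 3)"
    by (simp add: power2_eq_square algebra_simps)
  also have "\<dots> = 4 * ((2 * a + 1) * (2 * a + 3)) * (B\<^sup>2 * (2 * a + 1))"
    unfolding C by (simp add: power2_eq_square algebra_simps)
  also have "\<dots> \<le> 4 * (4 * (Suc a)\<^sup>2) * 16 ^ a"
  proof (rule mult_mono[OF mult_left_mono])
    show "(2 * a + 1) * (2 * a + 3) \<le> 4 * (Suc a)\<^sup>2" by (simp add: power2_eq_square algebra_simps)
    show "B\<^sup>2 * (2 * a + 1) \<le> 16 ^ a" using Suc.IH by (simp add: B_def)
  qed auto
  also have "\<dots> = (Suc a)\<^sup>2 * 16 ^ Suc a" by simp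
  finally have "C\<^sup>2 * (2 * Suc a + 1) \<le> 16 ^ Suc a" by simp
  then show ?case by (simp only: C_def)
qed

lemma card_bitstrings_weight_le:
  assumes "I \<subseteq> {1..M}"
  shows "card {Q \<in> bitstrings M. card {i \<in> I. Q i} = a} \<le> (card I choose a) * 2 ^ (M - card I)"
proof -
  let ?f = "\<lambda>Q::nat \<Rightarrow> bool. ({i \<in> I. Q i}, {i \<in> {1..M} - I. Q i})"
  let ?X = "{Q \<in> bitstrings M. card {i \<in> I. Q i} = a}"
  have fin: "finite I" using assms finite_subset by blast
  have "inj_on ?f ?X"
  proof (rule inj_onI)
    fix Q R assume Q: "Q \<in> ?X" "R \<in> ?X" "?f Q = ?f R"
    then have "Q i = R i" if "i \<in> {1..M}" for i
      using that assms by (cases "i \<in> I") blast+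
    then show "Q = R" using Q unfolding bitstrings_def by (intro PiE_ext[of Q _ _ R]) auto
  qed
  moreover have "?f ` ?X \<subseteq> {B. B \<subseteq> I \<and> card B = a} \<times> Pow ({1..M} - I)" by auto
  ultimately have "card ?X \<le> card ({B. B \<subseteq> I \<and> card B = a} \<times> Pow ({1..M} - I))"
    using fin by (intro card_inj_on_le) auto
  also have "\<dots> = (card I choose a) * 2 ^ (M - card I)"
    using fin assms by (simp add: card_cartesian_product n_subsets card_Pow card_Diff_subset)
  finally show ?thesis .
qed

text \<open>Complementing all bits cancels everything except the ties, which \<open>maj\<close> resolves to 0.\<close>

lemma sum_bit_sign_maj:
  assumes "I \<subseteq> {1..M}" "I \<noteq> {}"
  shows "(\<Sum>Q\<in>bitstrings M. bit_sign (maj I Q)) = real (card {Q \<in> bitstrings M. 2 * card {i \<in> I. Q i} = card I})"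
proof -
  define neg where "neg = (\<lambda>Q. \<lambda>i\<in>{1..M}. \<not> (Q i :: bool))"
  have fin: "finite I" using assms finite_subset by blast
  have fin_bits: "finite (bitstrings M)" by (simp add: bitstrings_def finite_PiE)
  have pair: "bit_sign (maj I Q) + bit_sign (maj I (neg Q)) = 2 * of_bool (2 * card {i \<in> I. Q i} = card I)" for Q
  proof -
    have "{i \<in> I. neg Q i} = I - {i \<in> I. Q i}" using assms(1) by (auto simp: neg_def)
    then have "card {i \<in> I. neg Q i} = card I - card {i \<in> I. Q i}" using fin by (simp add: card_Diff_subset)
    moreover have "card {i \<in> I. Q i} \<le> card I" using fin by (intro card_mono) auto
    ultimately show ?thesis using assms(2) by (auto simp: maj_def bit_sign_def)
  qed
  have neg_neg: "neg (neg Q) = Q" if "Q \<in> bitstrings M" for Q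
    using that PiE_arb[of Q "{1..M}" "\<lambda>_. UNIV"] by (auto simp: neg_def bitstrings_def restrict_def)
  have "neg Q \<in> bitstrings M" for Q by (simp add: neg_def bitstrings_def)
  then have "(\<Sum>Q\<in>bitstrings M. bit_sign (maj I Q)) = (\<Sum>Q\<in>bitstrings M. bit_sign (maj I (neg Q)))"
    by (intro sum.reindex_bij_witness[where i = neg and j = neg]) (simp_all add: neg_neg)
  then have "2 * (\<Sum>Q\<in>bitstrings M. bit_sign (maj I Q))
      = (\<Sum>Q\<in>bitstrings M. bit_sign (maj I Q) + bit_sign (maj I (neg Q)))"
    by (simp add: sum.distrib)
  also have "\<dots> = 2 * (\<Sum>Q\<in>bitstrings M. of_bool (2 * card {i \<in> I. Q i} = card I))"
    by (simp only: pair sum_distrib_left)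
  also have "(\<Sum>Q\<in>bitstrings M. of_bool (2 * card {i \<in> I. Q i} = card I))
      = real (card {Q \<in> bitstrings M. 2 * card {i \<in> I. Q i} = card I})"
    using fin_bits by (simp add: of_bool_def sum.If_cases Int_def)
  finally show ?thesis by simp
qed

text \<open>Only ties contribute, hence nothing for odd cardinality; for even cardinality their
  probability is at most 1 / sqrt (card I + 1), and 10^6 elements bring this below 1/1000.\<close>

lemma mean_maj_le:
  assumes "I \<subseteq> {1..M}" "10 ^ 6 \<le> card I"
  shows "(\<Sum>Q\<in>bitstrings M. 1 / 2 ^ M * bit_sign (maj I Q)) \<le> 1 / 1000"
proof -
  have "I \<noteq> {}" using assms(2) by auto
  have cardI: "card I \<le> M" using card_mono[OF _ assms(1)] by simp
  have "(\<Sum>Q\<in>bitstrings M. 1 / 2 ^ M * bit_sign (maj I Q))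
      = real (card {Q \<in> bitstrings M. 2 * card {i \<in> I. Q i} = card I}) / 2 ^ M"
    by (simp add: sum_bit_sign_maj[OF assms(1) \<open>I \<noteq> {}\<close>] flip: sum_divide_distrib)
  also have "\<dots> \<le> 1 / 1000"
  proof (cases "even (card I)")
    case False
    then have "{Q \<in> bitstrings M. 2 * card {i \<in> I. Q i} = card I} = {}"
      by (metis (mono_tags, lifting) dvd_triv_left empty_Collect_eq)
    then show ?thesis by (simp only: card.empty)
  next
    case True
    then obtain a where a: "card I = 2 * a" by blast
    have "real (card {Q \<in> bitstrings M. 2 * card {i \<in> I. Q i} = card I})
        = real (card {Q \<in> bitstrings M. card {i \<in> I. Q i} = a})" by (simp add: a)
    also have "\<dots> \<le> real (((2 * a) choose a) * 2 ^ (M - 2 * a))"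
      using card_bitstrings_weight_le[OF assms(1), of a] by (simp only: a of_nat_le_iff)
    finally have le: "real (card {Q \<in> bitstrings M. 2 * card {i \<in> I. Q i} = card I}) / 2 ^ M
        \<le> real (2 * a choose a) * 2 ^ (M - 2 * a) / 2 ^ M"
      by (simp add: divide_right_mono)
    have "(2::real) ^ M = 2 ^ (M - 2 * a) * 2 ^ (2 * a)"
      using cardI by (simp add: a flip: power_add)
    also have "(2::real) ^ (2 * a) = 4 ^ a" by (simp add: power_mult)
    finally have "(2::real) ^ M = 2 ^ (M - 2 * a) * 4 ^ a" .
    then have eq: "real (2 * a choose a) * 2 ^ (M - 2 * a) / 2 ^ M = real (2 * a choose a) / 4 ^ a"
      by simp
    have "(real (2 * a choose a))\<^sup>2 * 10 ^ 6 \<le> (real (2 * a choose a))\<^sup>2 * real (2 * a + 1)"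
      using assms(2) unfolding a by (intro mult_left_mono) (simp_all add: a)
    also have "\<dots> \<le> 16 ^ a"
      using central_binomial_sq_le[of a] by (metis of_nat_le_iff of_nat_mult of_nat_numeral of_nat_power)
    also have "\<dots> = (4 ^ a)\<^sup>2" by (simp add: power2_eq_square flip: power_mult_distrib)
    finally have "(real (2 * a choose a) * 1000)\<^sup>2 \<le> (4 ^ a)\<^sup>2" by (simp add: power_mult_distrib)
    then have "real (2 * a choose a) * 1000 \<le> 4 ^ a" by (rule power2_le_imp_le) simp
    then have "real (2 * a choose a) / 4 ^ a \<le> 1 / 1000" by (simp add: field_simps)
    then show ?thesis using le unfolding eq by (rule order_trans[rotated])
  qed
  finally show ?thesis .
qed

section \<open>Probability of a bad table\<close>

text \<open>The final failure probability must be a pure exponential: \<delta> may be as small as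
  exp (-N / c), which leaves no room for a prefactor. Halving the rate \<alpha> creates a gap into
  which two fast decaying terms fit.\<close>

lemma exp_tail_combine:
  assumes "0 < \<alpha>"
  obtains A :: real where "0 < A" "\<And>x. 1 \<le> x \<Longrightarrow> 2 * exp (- (A * x)) + exp (- (\<alpha> * x)) \<le> exp (- (\<alpha> / 2 * x))"
proof
  \<comment> \<open>For x >= 1 at least the fraction \<eta> of exp (-\<alpha> x / 2) is left over
    once exp (-\<alpha> x) is subtracted.\<close>
  define \<eta> where "\<eta> = 1 - exp (- (\<alpha> / 2))"
  define B where "B = ln (2 / \<eta>)"
  have \<eta>: "0 < \<eta>" "\<eta> < 1" using assms by (auto simp: \<eta>_def)
  then have B: "0 < B" by (simp add: B_def)
  show "0 < \<alpha> / 2 + B" using assms B by simp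
  show "2 * exp (- ((\<alpha> / 2 + B) * x)) + exp (- (\<alpha> * x)) \<le> exp (- (\<alpha> / 2 * x))" if x: "1 \<le> x" for x
  proof -
    have "B * 1 \<le> B * x" using x B by (intro mult_left_mono) auto
    then have "exp (- (B * x)) \<le> exp (- B)" by simp
    also have "\<dots> = \<eta> / 2" using \<eta> by (simp add: B_def exp_minus)
    finally have 1: "2 * exp (- (B * x)) \<le> \<eta>" by simp
    have "\<alpha> / 2 * 1 \<le> \<alpha> / 2 * x" using x assms by (intro mult_left_mono) auto
    then have 2: "exp (- (\<alpha> / 2 * x)) \<le> exp (- (\<alpha> / 2))" by simp
    have "2 * exp (- ((\<alpha> / 2 + B) * x)) + exp (- (\<alpha> * x))
        = exp (- (\<alpha> / 2 * x)) * (2 * exp (- (B * x)) + exp (- (\<alpha> / 2 * x)))"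
      by (simp add: algebra_simps flip: exp_add)
    also have "\<dots> \<le> exp (- (\<alpha> / 2 * x)) * 1"
      using 1 2 unfolding \<eta>_def by (intro mult_left_mono exp_ge_zero) linarith
    finally show ?thesis by simp
  qed
qed

text \<open>The summand exp (-N / 250000) is the failure probability of the final estimate on a good
  table; including it here turns the whole failure budget into one exponential.\<close>

lemma good_table_prob:
  fixes L :: nat
  obtains c :: real where "0 < c"
    "\<And>M N. 9 \<le> N \<Longrightarrow> c * real N \<le> real M \<Longrightarrow>
      expect (tables M N) (table_weight M N)
        (\<lambda>y. of_bool (card (selection M N y) < L \<or> real N / 1000 \<le> real (card (bad_shots M N y))))
      + exp (- (real N / 250000)) \<le> exp (- (real N / c))"
proof -
  obtain q where q: "0 < q" "q \<le> 1" "\<And>N. 9 \<le> N \<Longrightarrow> q \<le> selected_prob N"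
    by (rule selected_prob_lower) blast
  obtain A :: real where A: "0 < A"
    "\<And>x. 1 \<le> x \<Longrightarrow> 2 * exp (- (A * x)) + exp (- (1 / 250000 * x)) \<le> exp (- (1 / 250000 / 2 * x))"
    by (rule exp_tail_combine[of "1 / 250000"]) (simp, blast)
  define \<gamma> where "\<gamma> = (1 / 1000 * q)\<^sup>2 / (2 * exp 4)"
  have \<gamma>: "0 < \<gamma>" using q by (simp add: \<gamma>_def)
  \<comment> \<open>500000 weakens the combined rate to 1 / c. The second entry makes M q / 2 exceed
    (L + A) N, so few selected qubits are unlikely; the third makes M \<gamma> exceed (1 + A) N,
    where the extra N pays for the at most exp N sets of shots.\<close>
  define c where "c = max 500000 (max (2 * (real L + A) / q) ((1 + A) / \<gamma>))"
  have c: "500000 \<le> c" "2 * (real L + A) / q \<le> c" "(1 + A) / \<gamma> \<le> c"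
    by (simp_all add: c_def)
  show ?thesis
  proof (rule that[of c])
    show "0 < c" using c(1) by linarith
    fix M N :: nat
    assume N: "9 \<le> N" and M: "c * real N \<le> real M"
    let ?E = "expect (tables M N) (table_weight M N)"
    have few: "?E (\<lambda>y. of_bool (card (selection M N y) < L)) \<le> exp (- (A * real N))"
    proof -
      have "2 * (real L + A) \<le> c * q" using c(2) q by (simp add: field_simps)
      then have "2 * (real L + A) * real N \<le> c * q * real N" by (rule mult_right_mono) simp
      also have "\<dots> \<le> real M * q" using mult_right_mono[OF M, of q] q by (simp add: mult_ac)
      finally have "(real L + A) * real N \<le> real M * q / 2" by (simp add: algebra_simps)
      moreover have "real L * 1 \<le> real L * real N" using N by (intro mult_left_mono) auto
      ultimately have le: "real L - real M * q / 2 \<le> - (A * real N)"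
        unfolding distrib_right by simp
      have "?E (\<lambda>y. of_bool (card (selection M N y) < L))
          \<le> exp (real L) * exp (- (real M * q / 2))"
        by (rule few_selected_prob[OF q(3)[OF N]])
      also have "\<dots> = exp (real L - real M * q / 2)" by (simp flip: exp_add)
      also have "\<dots> \<le> exp (- (A * real N))" using le by simp
      finally show ?thesis .
    qed
    have many: "?E (\<lambda>y. of_bool (real N / 1000 \<le> real (card (bad_shots M N y)))) \<le> exp (- (A * real N))"
    proof -
      have "1 + A \<le> c * \<gamma>" using c(3) \<gamma> by (simp add: field_simps)
      then have "(1 + A) * real N \<le> c * \<gamma> * real N" by (rule mult_right_mono) simp
      also have "\<dots> \<le> real M * \<gamma>" using mult_right_mono[OF M, of \<gamma>] \<gamma> by (simp add: mult_ac)
      finally have le: "real N - real M * \<gamma> \<le> - (A * real N)" unfolding distrib_right by simp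
      have "?E (\<lambda>y. of_bool (real N / 1000 \<le> real (card (bad_shots M N y))))
          = ?E (\<lambda>y. of_bool (1 / 1000 * real N \<le> real (card (bad_shots M N y))))" by simp
      also have "\<dots> \<le> 2 ^ N * exp (- (real M * \<gamma>))"
        unfolding \<gamma>_def using N q by (intro many_bad_prob) auto
      also have "\<dots> \<le> exp (real N) * exp (- (real M * \<gamma>))"
      proof (rule mult_right_mono)
        have "(2::real) ^ N \<le> exp 1 ^ N"
          using exp_ge_add_one_self[of 1] by (intro power_mono) auto
        then show "2 ^ N \<le> exp (real N)" by (simp flip: exp_of_nat_mult)
      qed simp
      also have "\<dots> = exp (real N - real M * \<gamma>)" by (simp flip: exp_add)
      also have "\<dots> \<le> exp (- (A * real N))" using le by simp
      finally show ?thesis .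
    qed
    have "?E (\<lambda>y. of_bool (card (selection M N y) < L \<or> real N / 1000 \<le> real (card (bad_shots M N y))))
        \<le> ?E (\<lambda>y. of_bool (card (selection M N y) < L) + of_bool (real N / 1000 \<le> real (card (bad_shots M N y))))"
      by (rule expect_mono[OF prob_weights_tables]) (auto simp: of_bool_def)
    also have "\<dots> \<le> exp (- (A * real N)) + exp (- (A * real N))"
      unfolding expect_add using few many by (rule add_mono)
    finally have "?E (\<lambda>y. of_bool (card (selection M N y) < L \<or> real N / 1000 \<le> real (card (bad_shots M N y))))
        + exp (- (real N / 250000)) \<le> 2 * exp (- (A * real N)) + exp (- (1 / 250000 * real N))" by simp
    also have "\<dots> \<le> exp (- (1 / 250000 / 2 * real N))" using N by (intro A(2)) simp
    also have "\<dots> \<le> exp (- (real N / c))"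
    proof -
      have "real N / c \<le> real N / 500000" using c(1) by (intro divide_left_mono) auto
      then show ?thesis by simp
    qed
    finally show "?E (\<lambda>y. of_bool (card (selection M N y) < L \<or> real N / 1000 \<le> real (card (bad_shots M N y))))
        + exp (- (real N / 250000)) \<le> exp (- (real N / c))" .
  qed
qed

section \<open>From measurement records to tables\<close>

lemma maj_cong: "(\<And>i. i \<in> I \<Longrightarrow> Q i = R i) \<Longrightarrow> maj I Q = maj I R"
  by (simp add: maj_def cong: conj_cong)

lemma prod_nat_add_split:
  fixes f :: "nat \<Rightarrow> 'a::comm_monoid_mult"
  shows "(\<Prod>j\<in>{1..M + K}. f j) = (\<Prod>j\<in>{1..M}. f j) * (\<Prod>j\<in>{1..K}. f (M + j))"
  by (induction K) (simp_all add: prod.nat_ivl_Suc' mult_ac)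

text \<open>The support of \<open>p_hard\<close> is the graph of the majority map on the first M
  bits, and the majorities read only those bits because each \<open>enum J\<close> lies in
  \<open>{1..M}\<close>.\<close>

lemma sum_p_hard:
  assumes enum: "\<forall>J\<in>{1..2 ^ M}. enum J \<subseteq> {1..M}"
  shows "(\<Sum>Q\<in>bitstrings (M + 2 ^ M). p_hard M enum Q * f Q)
    = (\<Sum>x\<in>bitstrings M. 1 / 2 ^ M * f (\<lambda>i\<in>{1..M + 2 ^ M}. if i \<le> M then x i else maj (enum (i - M)) x))"
proof -
  let ?n = "M + 2 ^ M :: nat"
  define ext where "ext = (\<lambda>x. \<lambda>i\<in>{1..?n}. if i \<le> M then x i else maj (enum (i - M)) x)"
  define S where "S = {Q \<in> bitstrings ?n. \<forall>j\<in>{1..2 ^ M}. Q (M + j) = maj (enum j) Q}"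
  have ext_maj: "maj (enum j) (ext x) = maj (enum j) x" if "j \<in> {1..2 ^ M}" for x j
    using bspec[OF enum that] by (intro maj_cong) (auto simp: ext_def subset_iff)
  have restrict_maj: "maj (enum j) (restrict Q {1..M}) = maj (enum j) Q" if "j \<in> {1..2 ^ M}" for Q j
    using bspec[OF enum that] by (intro maj_cong) auto
  have "(\<Sum>Q\<in>bitstrings ?n. p_hard M enum Q * f Q) = (\<Sum>Q\<in>S. 1 / 2 ^ M * f Q)"
    by (rule sum.mono_neutral_cong_right) (auto simp: S_def p_hard_def)
  also have "\<dots> = (\<Sum>x\<in>bitstrings M. 1 / 2 ^ M * f (ext x))"
  proof (rule sum.reindex_bij_witness[where i = ext and j = "\<lambda>Q. restrict Q {1..M}"])
    fix Q assume Q: "Q \<in> S"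
    show "ext (restrict Q {1..M}) = Q"
    proof (rule PiE_ext[where k = "{1..?n}" and s = "\<lambda>_. UNIV"])
      fix i assume i: "i \<in> {1..?n}"
      show "ext (restrict Q {1..M}) i = Q i"
      proof (cases "i \<le> M")
        case True
        then show ?thesis using i by (simp add: ext_def)
      next
        case False
        then have j: "i - M \<in> {1..2 ^ M}" "M + (i - M) = i" using i by auto
        have "ext (restrict Q {1..M}) i = maj (enum (i - M)) Q"
          using i False restrict_maj[OF j(1)] by (simp add: ext_def)
        also have "\<dots> = Q (M + (i - M))" using Q j(1) by (simp add: S_def)
        finally show ?thesis by (simp only: j(2))
      qed
    qed (use Q in \<open>auto simp: ext_def S_def bitstrings_def\<close>)
    then show "1 / 2 ^ M * f (ext (restrict Q {1..M})) = 1 / 2 ^ M * f Q" by simp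
  next
    fix x assume x: "x \<in> bitstrings M"
    show "restrict (ext x) {1..M} = x"
      by (rule PiE_ext[where k = "{1..M}" and s = "\<lambda>_. UNIV"])
         (use x in \<open>auto simp: ext_def bitstrings_def\<close>)
    have "ext x (M + j) = maj (enum j) (ext x)" if "j \<in> {1..2 ^ M}" for j
      using that ext_maj[OF that] by (auto simp: ext_def)
    then show "ext x \<in> S" by (auto simp: S_def ext_def bitstrings_def)
  qed (simp add: bitstrings_def)
  finally show ?thesis unfolding ext_def .
qed

lemma rec_prob_rho_hard:
  assumes enum: "\<forall>J\<in>{1..2 ^ M}. enum J \<subseteq> {1..M}" and r: "r \<in> records (M + 2 ^ M)"
  shows "rec_prob (M + 2 ^ M) (rho_hard M enum) r
    = (\<Sum>x\<in>bitstrings M. (\<Prod>j\<in>{1..M}. shot_weight (x j) (r j) / 2)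
        * (\<Prod>J\<in>{1..2 ^ M}. shot_weight (maj (enum J) x) (r (M + J))))"
  unfolding rho_hard_def rec_prob_diag_state[OF r] sum_p_hard[OF enum]
proof (rule sum.cong[OF refl])
  fix x assume "x \<in> bitstrings M"
  have "(\<Prod>j\<in>{1..M}. shot_weight (x j) (r j) / 2) = 1 / 2 ^ M * (\<Prod>j\<in>{1..M}. shot_weight (x j) (r j))"
    by (simp add: prod_dividef)
  then show "1 / 2 ^ M * (\<Prod>j\<in>{1..M + 2 ^ M}. shot_weight
      ((\<lambda>i\<in>{1..M + 2 ^ M}. if i \<le> M then x i else maj (enum (i - M)) x) j) (r j))
    = (\<Prod>j\<in>{1..M}. shot_weight (x j) (r j) / 2)
        * (\<Prod>J\<in>{1..2 ^ M}. shot_weight (maj (enum J) x) (r (M + J)))"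
    unfolding prod_nat_add_split by (simp add: mult.assoc)
qed

lemma mtrace_Zq_rho_hard:
  assumes enum: "\<forall>J\<in>{1..2 ^ M}. enum J \<subseteq> {1..M}" and J: "J \<in> {1..2 ^ M}"
  shows "Re (mtrace (Zq (M + 2 ^ M) (M + J) * rho_hard M enum))
    = (\<Sum>x\<in>bitstrings M. 1 / 2 ^ M * bit_sign (maj (enum J) x))"
proof -
  have "M + J \<in> {1..M + 2 ^ M}" using J by auto
  then show ?thesis
    unfolding rho_hard_def mtrace_Zq_diag_state[OF \<open>M + J \<in> _\<close>]
      sum_p_hard[OF enum, of "\<lambda>Q. bit_sign (Q (M + J))"]
    using J by simp
qed

text \<open>The records are regrouped by qubit: column \<open>i \<le> M\<close> pairs the hidden bits of qubit \<open>i\<close> with its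
  records, and row \<open>J\<close> holds the records of qubit \<open>M + J\<close>. The columns are independent and identically
  distributed; given the columns, the rows are independent.\<close>

definition rows :: "nat \<Rightarrow> nat \<Rightarrow> (nat \<Rightarrow> nat \<Rightarrow> nat \<times> bool) set" where
  "rows K N = {1..K} \<rightarrow>\<^sub>E ({1..N} \<rightarrow>\<^sub>E rec_cells)"

definition row_weight :: "nat \<Rightarrow> nat set \<Rightarrow> (nat \<Rightarrow> nat \<Rightarrow> bool \<times> nat \<times> bool) \<Rightarrow> (nat \<Rightarrow> nat \<times> bool) \<Rightarrow> real" where
  "row_weight N I y = product_weight {1..N} (\<lambda>k. shot_weight (maj I (\<lambda>i. fst (y i k))))"

definition joined_shots :: "nat \<Rightarrow> nat \<Rightarrow> nat \<Rightarrow> (nat \<Rightarrow> nat \<Rightarrow> bool \<times> nat \<times> bool) \<Rightarrow>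
    (nat \<Rightarrow> nat \<Rightarrow> nat \<times> bool) \<Rightarrow> nat \<Rightarrow> nat \<Rightarrow> nat \<times> bool" where
  "joined_shots M K N y z =
     (\<lambda>k\<in>{1..N}. \<lambda>j\<in>{1..M + K}. if j \<le> M then snd (y j k) else z (j - M) k)"

lemma prob_weights_row: "prob_weights ({1..N} \<rightarrow>\<^sub>E rec_cells) (row_weight N I y)"
  unfolding row_weight_def
  by (intro prob_weights_product) (auto simp: prob_weights_rec_cells finite_rec_cells)

lemma joined_shots_in:
  assumes y: "y \<in> tables M N" and z: "z \<in> rows K N"
  shows "joined_shots M K N y z \<in> shots N (M + K)"
proof -
  have "snd (y j k) \<in> rec_cells" if "j \<in> {1..M}" "k \<in> {1..N}" for j k
    using PiE_mem[OF PiE_mem[OF y[unfolded tables_def] that(1), unfolded shot_columns_def] that(2)]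
    by (auto simp: cells_def rec_cells_def)
  moreover have "z j k \<in> rec_cells" if "j \<in> {1..K}" "k \<in> {1..N}" for j k
    using PiE_mem[OF PiE_mem[OF z[unfolded rows_def] that(1)] that(2)] .
  moreover have "j - M \<in> {1..K}" if "j \<in> {1..M + K}" "\<not> j \<le> M" for j
    using that by auto
  ultimately show ?thesis
    unfolding joined_shots_def shots_def records_def rec_cells_def[symmetric]
    by (intro restrict_PiE_iff[THEN iffD2] ballI) (simp del: One_nat_def)
qed

text \<open>A transposition of the data from shots to qubits. It is a plain bijection without
  weights, stated for arbitrary \<open>f\<close>.\<close>

lemma sum_shots_regroup:
  fixes f :: "(nat \<Rightarrow> nat \<Rightarrow> nat \<times> bool) \<Rightarrow> (nat \<Rightarrow> nat \<Rightarrow> bool) \<Rightarrow> real"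
  shows "(\<Sum>w\<in>shots N (M + K). \<Sum>X\<in>{1..N} \<rightarrow>\<^sub>E bitstrings M. f w X)
    = (\<Sum>y\<in>tables M N. \<Sum>z\<in>rows K N.
        f (joined_shots M K N y z) (\<lambda>k\<in>{1..N}. \<lambda>i\<in>{1..M}. fst (y i k)))"
  unfolding sum.cartesian_product
proof (rule sum.reindex_bij_witness[where
    i = "\<lambda>(y, z). (joined_shots M K N y z, \<lambda>k\<in>{1..N}. \<lambda>i\<in>{1..M}. fst (y i k))" and
    j = "\<lambda>(w, X). (\<lambda>i\<in>{1..M}. \<lambda>k\<in>{1..N}. (X k i, w k i), \<lambda>J\<in>{1..K}. \<lambda>k\<in>{1..N}. w k (M + J))"])
  fix p assume p: "p \<in> shots N (M + K) \<times> ({1..N} \<rightarrow>\<^sub>E bitstrings M)"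
  obtain w X where [simp]: "p = (w, X)" by (cases p)
  have w: "w \<in> shots N (M + K)" and X: "X \<in> {1..N} \<rightarrow>\<^sub>E bitstrings M" using p by auto
  have wk: "w k \<in> records (M + K)" if "k \<in> {1..N}" for k
    using PiE_mem[OF w[unfolded shots_def] that] .
  have wkj: "w k j \<in> rec_cells" if "k \<in> {1..N}" "j \<in> {1..M + K}" for k j
    using PiE_mem[OF wk[OF that(1), unfolded records_def] that(2)] by (simp add: rec_cells_def)
  have Xk: "X k \<in> bitstrings M" if "k \<in> {1..N}" for k using PiE_mem[OF X that] .
  let ?y = "\<lambda>i\<in>{1..M}. \<lambda>k\<in>{1..N}. (X k i, w k i)"
  let ?z = "\<lambda>J\<in>{1..K}. \<lambda>k\<in>{1..N}. w k (M + J)"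
  have y: "?y \<in> tables M N"
    using wkj by (auto simp: tables_def shot_columns_def cells_def rec_cells_def[symmetric] simp del: One_nat_def)
  have z: "?z \<in> rows K N"
    using wkj by (auto simp: rows_def simp del: One_nat_def)
  have 1: "joined_shots M K N ?y ?z = w"
  proof (rule PiE_ext[OF joined_shots_in[OF y z, unfolded shots_def] w[unfolded shots_def]])
    fix k assume k: "k \<in> {1..N}"
    have "joined_shots M K N ?y ?z k \<in> records (M + K)"
      using PiE_mem[OF joined_shots_in[OF y z, unfolded shots_def] k] .
    then show "joined_shots M K N ?y ?z k = w k"
      using wk[OF k] unfolding records_def
      by (rule PiE_ext) (use k in \<open>auto simp: joined_shots_def simp del: One_nat_def\<close>)
  qed
  have 2: "(\<lambda>k\<in>{1..N}. \<lambda>i\<in>{1..M}. fst (?y i k)) = X"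
  proof (rule PiE_ext[OF _ X])
    show "(\<lambda>k\<in>{1..N}. \<lambda>i\<in>{1..M}. fst (?y i k)) \<in> {1..N} \<rightarrow>\<^sub>E bitstrings M"
      by (auto simp: bitstrings_def)
    fix k assume k: "k \<in> {1..N}"
    then have "(\<lambda>k\<in>{1..N}. \<lambda>i\<in>{1..M}. fst (?y i k)) k \<in> bitstrings M" by (auto simp: bitstrings_def)
    then show "(\<lambda>k\<in>{1..N}. \<lambda>i\<in>{1..M}. fst (?y i k)) k = X k"
      using Xk[OF k] unfolding bitstrings_def
      by (rule PiE_ext) (use k in auto)
  qed
  show "(case case p of (w, X) \<Rightarrow> (\<lambda>i\<in>{1..M}. \<lambda>k\<in>{1..N}. (X k i, w k i), \<lambda>J\<in>{1..K}. \<lambda>k\<in>{1..N}. w k (M + J))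
      of (y, z) \<Rightarrow> (joined_shots M K N y z, \<lambda>k\<in>{1..N}. \<lambda>i\<in>{1..M}. fst (y i k))) = p"
    using 1 2 by simp
  show "(case p of (w, X) \<Rightarrow> (\<lambda>i\<in>{1..M}. \<lambda>k\<in>{1..N}. (X k i, w k i), \<lambda>J\<in>{1..K}. \<lambda>k\<in>{1..N}. w k (M + J)))
      \<in> tables M N \<times> rows K N"
    using y z by simp
  show "(case case p of (w, X) \<Rightarrow> (\<lambda>i\<in>{1..M}. \<lambda>k\<in>{1..N}. (X k i, w k i), \<lambda>J\<in>{1..K}. \<lambda>k\<in>{1..N}. w k (M + J))
      of (y, z) \<Rightarrow> f (joined_shots M K N y z) (\<lambda>k\<in>{1..N}. \<lambda>i\<in>{1..M}. fst (y i k)))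
      = (case p of (w, X) \<Rightarrow> f w X)"
    using 1 2 by simp
next
  fix p assume p: "p \<in> tables M N \<times> rows K N"
  obtain y z where [simp]: "p = (y, z)" by (cases p)
  have y: "y \<in> tables M N" and z: "z \<in> rows K N" using p by auto
  let ?w = "joined_shots M K N y z"
  let ?X = "\<lambda>k\<in>{1..N}. \<lambda>i\<in>{1..M}. fst (y i k)"
  have 1: "(\<lambda>i\<in>{1..M}. \<lambda>k\<in>{1..N}. (?X k i, ?w k i)) = y"
  proof
    fix i
    show "(\<lambda>i\<in>{1..M}. \<lambda>k\<in>{1..N}. (?X k i, ?w k i)) i = y i"
    proof (cases "i \<in> {1..M}")
      case True
      then have "y i \<in> {1..N} \<rightarrow>\<^sub>E cells" using y by (auto simp: tables_def shot_columns_def)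
      then have "restrict (y i) {1..N} = y i" by (rule PiE_restrict)
      moreover have "(\<lambda>k\<in>{1..N}. (?X k i, ?w k i)) = restrict (y i) {1..N}"
        using True by (intro restrict_ext) (auto simp: joined_shots_def simp del: One_nat_def)
      ultimately show ?thesis using True by simp
    next
      case False
      with y have "y i = undefined" unfolding tables_def by (intro PiE_arb)
      then show ?thesis by (simp only: restrict_apply False if_False)
    qed
  qed
  have 2: "(\<lambda>J\<in>{1..K}. \<lambda>k\<in>{1..N}. ?w k (M + J)) = z"
  proof
    fix J
    show "(\<lambda>J\<in>{1..K}. \<lambda>k\<in>{1..N}. ?w k (M + J)) J = z J"
    proof (cases "J \<in> {1..K}")
      case True
      then have "z J \<in> {1..N} \<rightarrow>\<^sub>E rec_cells" using z by (auto simp: rows_def)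
      then have "restrict (z J) {1..N} = z J" by (rule PiE_restrict)
      moreover have "(\<lambda>k\<in>{1..N}. ?w k (M + J)) = restrict (z J) {1..N}"
        using True by (intro restrict_ext) (auto simp: joined_shots_def simp del: One_nat_def)
      ultimately show ?thesis using True by simp
    next
      case False
      with z have "z J = undefined" unfolding rows_def by (intro PiE_arb)
      then show ?thesis by (simp only: restrict_apply False if_False)
    qed
  qed
  show "(case case p of (y, z) \<Rightarrow> (joined_shots M K N y z, \<lambda>k\<in>{1..N}. \<lambda>i\<in>{1..M}. fst (y i k))
      of (w, X) \<Rightarrow> (\<lambda>i\<in>{1..M}. \<lambda>k\<in>{1..N}. (X k i, w k i), \<lambda>J\<in>{1..K}. \<lambda>k\<in>{1..N}. w k (M + J))) = p"
    using 1 2 by (simp only: prod.case \<open>p = (y, z)\<close>)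
  have "?X \<in> {1..N} \<rightarrow>\<^sub>E bitstrings M" by (auto simp: bitstrings_def)
  then show "(case p of (y, z) \<Rightarrow> (joined_shots M K N y z, \<lambda>k\<in>{1..N}. \<lambda>i\<in>{1..M}. fst (y i k)))
      \<in> shots N (M + K) \<times> ({1..N} \<rightarrow>\<^sub>E bitstrings M)"
    using joined_shots_in[OF y z] by simp
qed

text \<open>The product over shots of mixtures is expanded into a sum over one hidden string per
  shot. After regrouping, the first M qubits contribute weights that factor over columns, while the
  weight of a row depends on the columns only through the hidden bits.\<close>

lemma snap_Prob_rho_hard:
  assumes enum: "\<forall>J\<in>{1..2 ^ M}. enum J \<subseteq> {1..M}"
  shows "snap_Prob N (M + 2 ^ M) (rho_hard M enum) E
    = expect (tables M N) (table_weight M N) (\<lambda>y.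
        expect (rows (2 ^ M) N) (product_weight {1..2 ^ M} (\<lambda>J. row_weight N (enum J) y))
          (\<lambda>z. of_bool (E (joined_shots M (2 ^ M) N y z))))"
proof -
  let ?n = "M + 2 ^ M :: nat"
  define g where "g = (\<lambda>(r :: nat \<Rightarrow> nat \<times> bool) x. (\<Prod>j\<in>{1..M}. shot_weight (x j) (r j) / 2)
        * (\<Prod>J\<in>{1..2 ^ M}. shot_weight (maj (enum J) x) (r (M + J))))"
  have "snap_Prob N ?n (rho_hard M enum) E
      = (\<Sum>w\<in>shots N ?n. \<Sum>X\<in>{1..N} \<rightarrow>\<^sub>E bitstrings M. of_bool (E w) * (\<Prod>k\<in>{1..N}. g (w k) (X k)))"
    unfolding snap_Prob_def
  proof (rule sum.cong[OF refl])
    fix w assume w: "w \<in> shots N ?n"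
    have "shots_prob N ?n (rho_hard M enum) w = (\<Prod>k\<in>{1..N}. \<Sum>x\<in>bitstrings M. g (w k) x)"
      unfolding shots_prob_def g_def
      using PiE_mem[OF w[unfolded shots_def]] by (intro prod.cong refl rec_prob_rho_hard[OF enum])
    also have "\<dots> = (\<Sum>X\<in>{1..N} \<rightarrow>\<^sub>E bitstrings M. \<Prod>k\<in>{1..N}. g (w k) (X k))"
      by (rule prod_sum_PiE) auto
    finally show "(if E w then shots_prob N ?n (rho_hard M enum) w else 0)
        = (\<Sum>X\<in>{1..N} \<rightarrow>\<^sub>E bitstrings M. of_bool (E w) * (\<Prod>k\<in>{1..N}. g (w k) (X k)))"
      by simp
  qed
  also have "\<dots> = (\<Sum>y\<in>tables M N. \<Sum>z\<in>rows (2 ^ M) N. of_bool (E (joined_shots M (2 ^ M) N y z)) *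
      (\<Prod>k\<in>{1..N}. g (joined_shots M (2 ^ M) N y z k) ((\<lambda>k\<in>{1..N}. \<lambda>i\<in>{1..M}. fst (y i k)) k)))"
    by (rule sum_shots_regroup)
  also have "\<dots> = (\<Sum>y\<in>tables M N. \<Sum>z\<in>rows (2 ^ M) N. of_bool (E (joined_shots M (2 ^ M) N y z)) *
      (table_weight M N y * product_weight {1..2 ^ M} (\<lambda>J. row_weight N (enum J) y) z))"
  proof (intro sum.cong refl arg_cong2[where f = times])
    fix y z
    have "(\<Prod>k\<in>{1..N}. g (joined_shots M (2 ^ M) N y z k) ((\<lambda>k\<in>{1..N}. \<lambda>i\<in>{1..M}. fst (y i k)) k))
        = (\<Prod>k\<in>{1..N}. (\<Prod>j\<in>{1..M}. cell_weight (y j k)) *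
            (\<Prod>J\<in>{1..2 ^ M}. shot_weight (maj (enum J) (\<lambda>i. fst (y i k))) (z J k)))"
    proof (rule prod.cong[OF refl])
      fix k assume k: "k \<in> {1..N}"
      have "maj (enum J) (\<lambda>i\<in>{1..M}. fst (y i k)) = maj (enum J) (\<lambda>i. fst (y i k))" if "J \<in> {1..2 ^ M}" for J
        using bspec[OF enum that] by (intro maj_cong) auto
      then show "g (joined_shots M (2 ^ M) N y z k) ((\<lambda>k\<in>{1..N}. \<lambda>i\<in>{1..M}. fst (y i k)) k)
        = (\<Prod>j\<in>{1..M}. cell_weight (y j k)) *
            (\<Prod>J\<in>{1..2 ^ M}. shot_weight (maj (enum J) (\<lambda>i. fst (y i k))) (z J k))"
        unfolding g_def using k
        by (intro arg_cong2[where f = times] prod.cong refl) (simp_all add: joined_shots_def cell_weight_def)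
    qed
    also have "\<dots> = (\<Prod>j\<in>{1..M}. \<Prod>k\<in>{1..N}. cell_weight (y j k)) *
        (\<Prod>J\<in>{1..2 ^ M}. \<Prod>k\<in>{1..N}. shot_weight (maj (enum J) (\<lambda>i. fst (y i k))) (z J k))"
      unfolding prod.distrib by (intro arg_cong2[where f = times] prod.swap)
    finally show "(\<Prod>k\<in>{1..N}. g (joined_shots M (2 ^ M) N y z k) ((\<lambda>k\<in>{1..N}. \<lambda>i\<in>{1..M}. fst (y i k)) k))
        = table_weight M N y * product_weight {1..2 ^ M} (\<lambda>J. row_weight N (enum J) y) z"
      by (simp add: table_weight_def column_weight_def row_weight_def product_weight_def)
  qed
  finally show ?thesis
    by (simp add: expect_def sum_distrib_left mult_ac)
qed

lemma est_joined_shots: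
  assumes "y \<in> tables M N" "z \<in> rows (2 ^ M) N"
  shows "i \<in> {1..M} \<Longrightarrow> est N (M + 2 ^ M) (joined_shots M (2 ^ M) N y z) (Zq (M + 2 ^ M) i)
      = 3 / real N * total N (y i)"
    and "J \<in> {1..2 ^ M} \<Longrightarrow> est N (M + 2 ^ M) (joined_shots M (2 ^ M) N y z) (Zq (M + 2 ^ M) (M + J))
      = 3 / real N * (\<Sum>k\<in>{1..N}. shot_value (z J k))"
proof -
  let ?n = "M + 2 ^ M :: nat" and ?w = "joined_shots M (2 ^ M) N y z"
  have est: "est N ?n ?w (Zq ?n i) = 3 / real N * (\<Sum>k\<in>{1..N}. shot_value (?w k i))" if "i \<in> {1..?n}" for i
  proof -
    have "(\<Sum>k\<in>{1..N}. Re (mtrace (Zq ?n i * snapshot ?n (?w k)))) = (\<Sum>k\<in>{1..N}. 3 * shot_value (?w k i))"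
      using that PiE_mem[OF joined_shots_in[OF assms, unfolded shots_def]]
      by (intro sum.cong refl mtrace_Zq_snapshot)
    then show ?thesis by (simp add: est_def sum_distrib_left)
  qed
  show "est N ?n ?w (Zq ?n i) = 3 / real N * total N (y i)" if i: "i \<in> {1..M}"
  proof -
    have "i \<in> {1..?n}" using i by auto
    then show ?thesis unfolding est[OF \<open>i \<in> {1..?n}\<close>] total_def
      using i by (intro arg_cong2[where f = times] refl sum.cong) (simp add: joined_shots_def)
  qed
  show "est N ?n ?w (Zq ?n (M + J)) = 3 / real N * (\<Sum>k\<in>{1..N}. shot_value (z J k))" if J: "J \<in> {1..2 ^ M}"
  proof -
    have "M + J \<in> {1..?n}" using J by auto
    then show ?thesis unfolding est[OF \<open>M + J \<in> {1..?n}\<close>]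
      using J by (intro arg_cong2[where f = times] refl sum.cong) (simp add: joined_shots_def)
  qed
qed

lemma analyst_I_joined_shots:
  assumes "y \<in> tables M N" "z \<in> rows (2 ^ M) N" "1 \<le> N"
  shows "analyst_I M N (joined_shots M (2 ^ M) N y z) = selection M N y"
proof -
  have "9 / sqrt (real N) \<le> 3 / real N * T \<longleftrightarrow> 3 * sqrt (real N) \<le> T" for T
  proof -
    have "9 / sqrt (real N) = 3 / real N * (3 * sqrt (real N))"
      using real_div_sqrt[of "real N"] assms(3) by (simp add: divide_simps)
    then show ?thesis using assms(3) by (simp add: divide_le_cancel)
  qed
  then show ?thesis
    using est_joined_shots(1)[OF assms(1,2)] by (auto simp: analyst_I_def selection_def selected_def)
qed

lemma analyst_j_eq:
  assumes "bij_betw enum {1..2 ^ M} (Pow {1..M})" "J \<in> {1..2 ^ M}" "enum J = analyst_I M N w"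
  shows "analyst_j M enum N w = J"
  unfolding analyst_j_def
  using assms by (intro the_equality) (auto simp: bij_betw_def inj_on_def)

text \<open>Only the row picked by the analyst matters, and that row is independent of the selection.\<close>

lemma snap_Prob_analyst:
  assumes bij: "bij_betw enum {1..2 ^ M} (Pow {1..M})" and N: "1 \<le> N"
  shows "snap_Prob N (M + 2 ^ M) (rho_hard M enum)
      (\<lambda>w. let n = M + 2 ^ M; Zj = Zq n (M + analyst_j M enum N w) in
         \<bar>est N n w Zj - Re (mtrace (Zj * rho_hard M enum))\<bar> \<ge> 0.99)
    = expect (tables M N) (table_weight M N) (\<lambda>y.
        expect ({1..N} \<rightarrow>\<^sub>E rec_cells) (row_weight N (selection M N y) y)
          (\<lambda>c. of_bool (\<bar>3 / real N * (\<Sum>k\<in>{1..N}. shot_value (c k))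
             - (\<Sum>x\<in>bitstrings M. 1 / 2 ^ M * bit_sign (maj (selection M N y) x))\<bar> \<ge> 0.99)))"
proof -
  have enum: "\<forall>J\<in>{1..2 ^ M}. enum J \<subseteq> {1..M}"
    using bij_betw_imp_surj_on[OF bij] by auto
  show ?thesis
    unfolding snap_Prob_rho_hard[OF enum]
  proof (rule expect_cong)
    fix y assume y: "y \<in> tables M N"
    define \<mu> where "\<mu> = (\<Sum>x\<in>bitstrings M. 1 / 2 ^ M * bit_sign (maj (selection M N y) x))"
    have "selection M N y \<in> enum ` {1..2 ^ M}"
      using bij_betw_imp_surj_on[OF bij] by (auto simp: selection_def)
    then obtain J where J: "J \<in> {1..2 ^ M}" "enum J = selection M N y" by auto
    let ?P = "\<lambda>c. of_bool (\<bar>3 / real N * (\<Sum>k\<in>{1..N}. shot_value (c k)) - \<mu>\<bar> \<ge> 0.99) :: real"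
    have "expect (rows (2 ^ M) N) (product_weight {1..2 ^ M} (\<lambda>J. row_weight N (enum J) y))
        (\<lambda>z. of_bool (let n = M + 2 ^ M; Zj = Zq n (M + analyst_j M enum N (joined_shots M (2 ^ M) N y z)) in
           \<bar>est N n (joined_shots M (2 ^ M) N y z) Zj - Re (mtrace (Zj * rho_hard M enum))\<bar> \<ge> 0.99))
      = expect (rows (2 ^ M) N) (product_weight {1..2 ^ M} (\<lambda>J. row_weight N (enum J) y)) (\<lambda>z. ?P (z J))"
    proof (rule expect_cong)
      fix z assume z: "z \<in> rows (2 ^ M) N"
      have "analyst_j M enum N (joined_shots M (2 ^ M) N y z) = J"
        by (rule analyst_j_eq[OF bij J(1)]) (simp add: J(2) analyst_I_joined_shots[OF y z N])
      then show "of_bool (let n = M + 2 ^ M; Zj = Zq n (M + analyst_j M enum N (joined_shots M (2 ^ M) N y z)) in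
           \<bar>est N n (joined_shots M (2 ^ M) N y z) Zj - Re (mtrace (Zj * rho_hard M enum))\<bar> \<ge> 0.99) = ?P (z J)"
        by (simp only: Let_def est_joined_shots(2)[OF y z J(1)] mtrace_Zq_rho_hard[OF enum J(1)] J(2) \<mu>_def)
    qed
    also have "\<dots> = expect ({1..N} \<rightarrow>\<^sub>E rec_cells) (row_weight N (enum J) y) ?P"
      unfolding rows_def
      by (rule expect_coordinate[OF _ prob_weights_row _ J(1)]) (auto intro: finite_PiE finite_rec_cells)
    finally show "expect (rows (2 ^ M) N) (product_weight {1..2 ^ M} (\<lambda>J. row_weight N (enum J) y))
        (\<lambda>z. of_bool (let n = M + 2 ^ M; Zj = Zq n (M + analyst_j M enum N (joined_shots M (2 ^ M) N y z)) in
           \<bar>est N n (joined_shots M (2 ^ M) N y z) Zj - Re (mtrace (Zj * rho_hard M enum))\<bar> \<ge> 0.99))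
      = expect ({1..N} \<rightarrow>\<^sub>E rec_cells) (row_weight N (selection M N y) y)
          (\<lambda>c. of_bool (\<bar>3 / real N * (\<Sum>k\<in>{1..N}. shot_value (c k))
             - (\<Sum>x\<in>bitstrings M. 1 / 2 ^ M * bit_sign (maj (selection M N y) x))\<bar> \<ge> 0.99))"
      unfolding J(2) \<mu>_def .
  qed
qed

section \<open>The overfitting bound\<close>

text \<open>The estimate is at least 3 * 991/3000 = 0.991 and the true mean at most 0.001; a
  one-sided bound on the mean is enough as the estimate lies above it.\<close>

lemma row_success_good:
  assumes N: "1 \<le> N" and "10 ^ 6 \<le> card (selection M N y)" "real (card (bad_shots M N y)) \<le> real N / 1000"
  shows "1 - exp (- (real N / 250000)) \<le> expect ({1..N} \<rightarrow>\<^sub>E rec_cells) (row_weight N (selection M N y) y)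
      (\<lambda>c. of_bool (\<bar>3 / real N * (\<Sum>k\<in>{1..N}. shot_value (c k))
         - (\<Sum>x\<in>bitstrings M. 1 / 2 ^ M * bit_sign (maj (selection M N y) x))\<bar> \<ge> 0.99))"
proof -
  let ?E = "expect ({1..N} \<rightarrow>\<^sub>E rec_cells) (row_weight N (selection M N y) y)"
  define \<mu> where "\<mu> = (\<Sum>x\<in>bitstrings M. 1 / 2 ^ M * bit_sign (maj (selection M N y) x))"
  have \<mu>: "\<mu> \<le> 1 / 1000"
    unfolding \<mu>_def by (rule mean_maj_le[OF _ assms(2)]) (auto simp: selection_def)
  have "?E (\<lambda>c. of_bool ((\<Sum>k\<in>{1..N}. shot_value (c k)) < 991 / 3000 * real N)) \<le> exp (- (real N / 250000))"
    unfolding row_weight_def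
    by (rule majority_deviation) (use assms(3) in \<open>simp add: bad_shots_def\<close>)
  then have "1 - exp (- (real N / 250000))
      \<le> ?E (\<lambda>c. 1 - of_bool ((\<Sum>k\<in>{1..N}. shot_value (c k)) < 991 / 3000 * real N))"
    unfolding expect_diff expect_const[OF prob_weights_row] by linarith
  also have "\<dots> \<le> ?E (\<lambda>c. of_bool (\<bar>3 / real N * (\<Sum>k\<in>{1..N}. shot_value (c k)) - \<mu>\<bar> \<ge> 0.99))"
  proof (rule expect_mono[OF prob_weights_row])
    fix c
    have "0.99 \<le> \<bar>3 / real N * T - \<mu>\<bar>" if "\<not> T < 991 / 3000 * real N" for T
    proof -
      have "3 / real N * (991 / 3000 * real N) \<le> 3 / real N * T"
        using that by (intro mult_left_mono) auto
      then show ?thesis using \<mu> N by simp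
    qed
    then show "1 - of_bool ((\<Sum>k\<in>{1..N}. shot_value (c k)) < 991 / 3000 * real N)
        \<le> (of_bool (\<bar>3 / real N * (\<Sum>k\<in>{1..N}. shot_value (c k)) - \<mu>\<bar> \<ge> 0.99) :: real)"
      by (auto simp: of_bool_def)
  qed
  finally show ?thesis unfolding \<mu>_def .
qed

text \<open>With fewer than 9 shots the threshold exceeds the largest possible estimate 3, so nothing is
  selected and the queried observable is identically 1.\<close>

lemma row_success_few_shots:
  assumes N: "1 \<le> N" "N \<le> 8" and y: "y \<in> tables M N"
  shows "(2 / 3) ^ 8 \<le> expect ({1..N} \<rightarrow>\<^sub>E rec_cells) (row_weight N (selection M N y) y)
      (\<lambda>c. of_bool (\<bar>3 / real N * (\<Sum>k\<in>{1..N}. shot_value (c k))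
         - (\<Sum>x\<in>bitstrings M. 1 / 2 ^ M * bit_sign (maj (selection M N y) x))\<bar> \<ge> 0.99))"
proof -
  have "\<not> selected N c" for c
  proof -
    have "total N c \<le> (\<Sum>k\<in>{1..N}. 1)"
      unfolding total_def by (rule sum_mono) (simp add: shot_value_def)
    also have "\<dots> = sqrt (real N) * sqrt (real N)" by simp
    also have "\<dots> < 3 * sqrt (real N)"
      using N by (intro mult_strict_right_mono real_less_lsqrt) auto
    finally show ?thesis by (simp add: selected_def)
  qed
  then have sel: "selection M N y = {}" by (simp add: selection_def)
  have \<mu>: "(\<Sum>x\<in>bitstrings M. 1 / 2 ^ M * bit_sign (maj {} x)) = (1::real)"
    by (simp add: maj_def bit_sign_def) (simp add: bitstrings_def card_PiE)
  let ?E = "expect ({1..N} \<rightarrow>\<^sub>E rec_cells) (row_weight N {} y)"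
  have "(2 / 3) ^ 8 \<le> (2 / 3 :: real) ^ N" using N by (intro power_decreasing) auto
  also have "\<dots> \<le> ?E (\<lambda>c. of_bool ((\<Sum>k\<in>{1..N}. shot_value (c k)) = 0))"
    unfolding row_weight_def using all_unmeasured_prob[of N] by (simp add: maj_def)
  also have "\<dots> \<le> ?E (\<lambda>c. of_bool (\<bar>3 / real N * (\<Sum>k\<in>{1..N}. shot_value (c k)) - 1\<bar> \<ge> 0.99))"
    by (rule expect_mono[OF prob_weights_row]) (auto simp: of_bool_def)
  finally show ?thesis unfolding sel \<mu> .
qed

theorem mainTheorem7:
  "\<exists>c::real. c > 0 \<and>
     (\<forall>(M::nat) (N::nat) (\<delta>::real) (enum :: nat \<Rightarrow> nat set).
        0 < \<delta> \<and> \<delta> < 1 \<and>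
        bij_betw enum {1..2 ^ M} (Pow {1..M}) \<and>
        real M \<ge> c * max (real N) (ln (1 / \<delta>)) \<and>
        real N \<ge> c * ln (1 / \<delta>) \<longrightarrow>
        snap_Prob N (M + 2 ^ M) (rho_hard M enum)
          (\<lambda>w. let n = M + 2 ^ M; Zj = Zq n (M + analyst_j M enum N w) in
               \<bar>est N n w Zj - Re (mtrace (Zj * rho_hard M enum))\<bar> \<ge> 0.99)
        \<ge> 1 - \<delta>)"
proof -
  obtain C :: real where C: "0 < C"
    "\<And>M N. 9 \<le> N \<Longrightarrow> C * real N \<le> real M \<Longrightarrow>
      expect (tables M N) (table_weight M N)
        (\<lambda>y. of_bool (card (selection M N y) < 10 ^ 6 \<or> real N / 1000 \<le> real (card (bad_shots M N y))))
      + exp (- (real N / 250000)) \<le> exp (- (real N / C))"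
    by (rule good_table_prob[where L = "10 ^ 6"]) blast
  \<comment> \<open>\<open>C\<close> serves N >= 9. For N <= 8 the factor 300 forces ln (1 /
    \<delta>) <= 8/300, which lies below the success probability (2/3)^8.\<close>
  define c where "c = max C 300"
  have c: "C \<le> c" "300 \<le> c" by (simp_all add: c_def)
  show ?thesis
  proof (intro exI[of _ c] conjI allI impI)
    show "0 < c" using c(2) by linarith
    fix M N :: nat and \<delta> :: real and enum :: "nat \<Rightarrow> nat set"
    assume A: "0 < \<delta> \<and> \<delta> < 1 \<and> bij_betw enum {1..2 ^ M} (Pow {1..M}) \<and>
        real M \<ge> c * max (real N) (ln (1 / \<delta>)) \<and> real N \<ge> c * ln (1 / \<delta>)"
    then have \<delta>: "0 < \<delta>" "\<delta> < 1" and bij: "bij_betw enum {1..2 ^ M} (Pow {1..M})"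
      and M: "c * max (real N) (ln (1 / \<delta>)) \<le> real M" and N: "c * ln (1 / \<delta>) \<le> real N"
      by auto
    \<comment> \<open>The strict bound \<delta> < 1 excludes N = 0, for which the averages would be
      divisions by zero.\<close>
    have ln_pos: "0 < ln (1 / \<delta>)" using \<delta> by simp
    then have "0 < c * ln (1 / \<delta>)" using \<open>0 < c\<close> by simp
    then have N1: "1 \<le> N" using N by (cases N) auto
    let ?E = "expect (tables M N) (table_weight M N)"
    let ?R = "\<lambda>y. expect ({1..N} \<rightarrow>\<^sub>E rec_cells) (row_weight N (selection M N y) y)
        (\<lambda>c. of_bool (\<bar>3 / real N * (\<Sum>k\<in>{1..N}. shot_value (c k))
           - (\<Sum>x\<in>bitstrings M. 1 / 2 ^ M * bit_sign (maj (selection M N y) x))\<bar> \<ge> 0.99))"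
    have "1 - \<delta> \<le> ?E ?R"
    proof (cases "9 \<le> N")
      case True
      let ?bad = "\<lambda>y. card (selection M N y) < 10 ^ 6 \<or> real N / 1000 \<le> real (card (bad_shots M N y))"
      have "C * real N \<le> c * max (real N) (ln (1 / \<delta>))"
        using c \<open>0 < c\<close> by (intro mult_mono) auto
      then have "C * real N \<le> real M" using M by linarith
      from C(2)[OF True this]
      have bound: "?E (\<lambda>y. of_bool (?bad y)) + exp (- (real N / 250000)) \<le> exp (- (real N / C))" .
      have "C * ln (1 / \<delta>) \<le> c * ln (1 / \<delta>)" using c(1) ln_pos by (intro mult_right_mono) auto
      then have "ln (1 / \<delta>) \<le> real N / C" using N C(1) by (simp add: field_simps)
      then have "exp (- (real N / C)) \<le> exp (- ln (1 / \<delta>))" by simp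
      also have "\<dots> = \<delta>" using \<delta> by (simp add: exp_minus)
      finally have "1 - \<delta> \<le> 1 - exp (- (real N / 250000)) - ?E (\<lambda>y. of_bool (?bad y))"
        using bound by linarith
      also have "\<dots> = ?E (\<lambda>y. 1 - exp (- (real N / 250000)) - of_bool (?bad y))"
        unfolding expect_diff expect_const[OF prob_weights_tables] ..
      also have "\<dots> \<le> ?E ?R"
      proof (rule expect_mono[OF prob_weights_tables])
        fix y
        show "1 - exp (- (real N / 250000)) - of_bool (?bad y) \<le> ?R y"
        proof (cases "?bad y")
          case True
          have "expect ({1..N} \<rightarrow>\<^sub>E rec_cells) (row_weight N (selection M N y) y) (\<lambda>_. 0) \<le> ?R y"
            by (rule expect_mono[OF prob_weights_row]) simp
          then have "0 \<le> ?R y" unfolding expect_const[OF prob_weights_row] .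
          moreover have "1 - exp (- (real N / 250000)) - of_bool (?bad y) \<le> 0" using True by (simp only: of_bool_eq) simp
          ultimately show ?thesis by (rule order_trans[rotated])
        next
          case False
          then have "10 ^ 6 \<le> card (selection M N y)" "real (card (bad_shots M N y)) \<le> real N / 1000"
            by (simp_all only: de_Morgan_disj not_less not_le order_less_imp_le)
          from row_success_good[OF N1 this] False show ?thesis by (simp only: of_bool_eq diff_zero)
        qed
      qed
      finally show ?thesis .
    next
      case False
      \<comment> \<open>With so few shots \<delta> is forced close to 1, so only a tiny success
        probability has to be guaranteed.\<close>
      have "1 - \<delta> \<le> - ln \<delta>" using ln_le_minus_one[of \<delta>] \<delta> by simp
      also have "\<dots> = ln (1 / \<delta>)" using \<delta> by (simp add: ln_div)
      also have "300 * \<dots> \<le> 8"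
      proof -
        have "300 * ln (1 / \<delta>) \<le> c * ln (1 / \<delta>)" using c(2) ln_pos by (intro mult_right_mono) auto
        then show ?thesis using N False by simp
      qed
      then have "ln (1 / \<delta>) \<le> 8 / 300" by simp
      also have "8 / 300 \<le> ((2 / 3) ^ 8 :: real)" by (simp add: power_divide)
      also have "(2 / 3) ^ 8 = ?E (\<lambda>_. (2 / 3) ^ 8)" by (rule expect_const[OF prob_weights_tables, symmetric])
      also have "\<dots> \<le> ?E ?R"
        using N1 False by (intro expect_mono[OF prob_weights_tables] row_success_few_shots) auto
      finally show ?thesis .
    qed
    then show "1 - \<delta> \<le> snap_Prob N (M + 2 ^ M) (rho_hard M enum)
          (\<lambda>w. let n = M + 2 ^ M; Zj = Zq n (M + analyst_j M enum N w) in
               \<bar>est N n w Zj - Re (mtrace (Zj * rho_hard M enum))\<bar> \<ge> 0.99)"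
      unfolding snap_Prob_analyst[OF bij N1] .
  qed
qed

end
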